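(* Let $d\geq 1$. Every convex body $K\subset\mathbb{R}^d$ satisfies $I^*(K)\leq 2^d$, where $I^*(K)$ is the fractional illumination number of $K$. Moreover, equality $I^*(K)=2^d$ holds if and only if $K$ is a parallelotope.
   Context: A convex body in $\mathbb{R}^d$ is a compact convex subset of $\mathbb{R}^d$ with nonempty interior. $S^{d-1}$ is the Euclidean unit sphere of $\mathbb{R}^d$, and $\operatorname{int}K$, $\partial K$ denote the interior and boundary of $K$. A direction $u\in S^{d-1}$ illuminates a point $x\in\partial K$ if $x+tu\in\operatorname{int}K$ for some $t>0$. The fractional illumination number $I^*(K)$ is the infimum of $\sum_{j=1}^m w_j$ over all finite families $u_1,\dots,u_m\in S^{d-1}$ and weights $w_1,\dots,w_m\geq 0$ satisfying $$\sum_{j:\,u_j\text{ illuminates }x} w_j\geq 1\qquad\text{for every }x\in\partial K.$$ A parallelotope in $\mathbb{R}^d$ is an image of $[-1,1]^d$ under an invertible affine map of $\mathbb{R}^d$. *)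

theory Defs
  imports "HOL-Analysis.Analysis"
begin

definition convex_body :: "(real ^ 'n) set \<Rightarrow> bool" where
  "convex_body K \<longleftrightarrow> compact K \<and> convex K \<and> interior K \<noteq> {}"

definition illuminates :: "(real ^ 'n) set \<Rightarrow> real ^ 'n \<Rightarrow> real ^ 'n \<Rightarrow> bool" where
  "illuminates K u x \<longleftrightarrow> (\<exists>t>0. x + t *\<^sub>R u \<in> interior K)"

definition fractional_illumination ::
    "(real ^ 'n) set \<Rightarrow> nat \<Rightarrow> (nat \<Rightarrow> real ^ 'n) \<Rightarrow> (nat \<Rightarrow> real) \<Rightarrow> bool" where
  "fractional_illumination K m u w \<longleftrightarrow>
     (\<forall>j<m. u j \<in> sphere 0 1 \<and> 0 \<le> w j) \<and>
     (\<forall>x\<in>frontier K. (\<Sum>j\<in>{j. j < m \<and> illuminates K (u j) x}. w j) \<ge> 1)"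

text \<open>The infimum is taken in the extended reals, so that it would be \<open>\<infinity>\<close> (rather than an
  unspecified real number) if no admissible weighted family existed.\<close>

definition fractional_illumination_number :: "(real ^ 'n) set \<Rightarrow> ereal" where
  "fractional_illumination_number K =
     Inf {ereal (\<Sum>j<m. w j) | m u w. fractional_illumination K m u w}"

definition parallelotope :: "(real ^ 'n) set \<Rightarrow> bool" where
  "parallelotope P \<longleftrightarrow>
     (\<exists>f b. linear f \<and> bij f \<and> P = (\<lambda>x. f x + b) ` {x :: real ^ 'n. \<forall>i. x $ i \<in> {-1..1}})"

end

theory Submission
  imports Defs
begin

text \<open>
  For every probability measure \<open>\<mu>\<close> on a convex body \<open>K\<close> and independent \<open>X, X'\<close> with law \<open>\<mu>\<close> and \<open>k\<close> uniform in
  \<open>K\<close>, consider the probability that \<open>X + (k - X') \<in> K\<close>. Up to the factor \<open>vol K\<close> it is the energy of \<open>\<mu>\<close>, the double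
  integral of \<open>vol (K \<inter> (z + K))\<close> over the differences \<open>z = X - X'\<close>. This kernel is symmetric, so the energy is also
  the square integral of \<open>z \<mapsto> \<mu> (z - K)\<close>, a function of integral \<open>vol K\<close> that lives on \<open>2K\<close>. By the
  Cauchy--Schwarz inequality the probability is at least \<open>(1/2)\<^sup>d\<close>.

  Now let \<open>\<mu>\<close> minimise the energy. First order optimality says that the potential is at least the energy at every
  point \<open>x\<close> of \<open>K\<close>: for each single \<open>x\<close>, the random direction \<open>k - X'\<close> moves \<open>x\<close> into \<open>K\<close> with probability at
  least \<open>(1/2)\<^sup>d\<close>, and almost surely not onto the boundary, as \<open>k\<close> has a density.
  So its law, divided by that probability, is a fractional illumination of weight at most
  \<open>2\<^sup>d\<close>. The lemmas \<open>potential_nearly_ge\<close> and \<open>illumination_number_le_potential\<close> carry this out with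
  near minimisers of finite support and with a finite set of directions.

  If the illumination number equals \<open>2\<^sup>d\<close>, the inequality is sharp, and \<open>\<mu> (z - K)\<close> is nearly constant on \<open>2K\<close> for
  near minimisers. Near twice an extreme point \<open>v\<close> this function sees only the mass near \<open>v\<close>. Hence each extreme
  point carries mass \<open>(1/2)\<^sup>d\<close> in the limit, nothing else carries mass, there are exactly \<open>2\<^sup>d\<close> extreme points, and the
  translates \<open>v + K\<close> tile \<open>2K\<close> (\<open>vertex_translates_tile\<close>). So \<open>K\<close> is a polytope tiled by its own half size
  copies at the vertices. Comparing the volumes of thin slabs parallel to a facet shows that every vertex lies either on
  this facet or at maximal distance from it (\<open>facet_two_levels\<close>): a vertex at an intermediate level would make the slab volumes
  drop abruptly at that level. Finally \<open>d\<close> independent facet normals map the \<open>2\<^sup>d\<close> vertices onto the vertices of a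
  cube. Conversely, the \<open>2\<^sup>d\<close> vertices of a parallelotope need pairwise different directions.
\<close>

section \<open>Energy of a finitely supported probability measure on a body\<close>

lemma measure_homothety:
  fixes S :: "'a::euclidean_space set"
  shows "measure lebesgue ((\<lambda>x. q + c *\<^sub>R (x - q)) ` S) = \<bar>c\<bar> ^ DIM('a) * measure lebesgue S"
proof -
  have "(\<lambda>x. q + c *\<^sub>R (x - q)) = (\<lambda>x. c *\<^sub>R x + (q - c *\<^sub>R q))"
    by (auto simp: algebra_simps)
  then show ?thesis
    using measure_lebesgue_affine[of c "q - c *\<^sub>R q" S] by (simp only:)
qed

lemma measure_scaleR_image:
  fixes S :: "'a::euclidean_space set"
  shows "measure lebesgue ((*\<^sub>R) c ` S) = \<bar>c\<bar> ^ DIM('a) * measure lebesgue S"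
  using measure_lebesgue_affine[of c 0 S] by simp

text \<open>
  \<open>K \<inter> (z + K)\<close> measures how likely a uniform point \<open>k\<close> of \<open>K\<close> is to stay in \<open>K\<close> after
  translation by \<open>- z\<close>. It is the autocorrelation of the indicator of \<open>K\<close>, hence a positive definite
  kernel; the energy and the potential below are those of this kernel.
\<close>

definition overlap :: "'a::euclidean_space set \<Rightarrow> 'a \<Rightarrow> real" where
  "overlap K z = measure lebesgue (K \<inter> (+) z ` K)"

definition prob_weights :: "'a set \<Rightarrow> 'a set \<Rightarrow> ('a \<Rightarrow> real) \<Rightarrow> bool" where
  "prob_weights K X p \<longleftrightarrow> finite X \<and> X \<subseteq> K \<and> (\<forall>x\<in>X. 0 \<le> p x) \<and> sum p X = 1"

definition potential :: "'a::euclidean_space set \<Rightarrow> 'a set \<Rightarrow> ('a \<Rightarrow> real) \<Rightarrow> 'a \<Rightarrow> real" where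
  "potential K X p z = (\<Sum>x\<in>X. p x * overlap K (z - x))"

definition energy :: "'a::euclidean_space set \<Rightarrow> 'a set \<Rightarrow> ('a \<Rightarrow> real) \<Rightarrow> real" where
  "energy K X p = (\<Sum>x\<in>X. p x * potential K X p x)"

text \<open>
  The \<open>p\<close>-mass of \<open>z - K\<close>; it is the density of the sum of a \<open>p\<close>-random point and a uniform point of
  \<open>K\<close>, multiplied by the volume of \<open>K\<close>.
\<close>

definition cover :: "'a::euclidean_space set \<Rightarrow> 'a set \<Rightarrow> ('a \<Rightarrow> real) \<Rightarrow> 'a \<Rightarrow> real" where
  "cover K X p z = (\<Sum>x\<in>X. p x * indicator ((+) x ` K) z)"

lemma mem_translate_iff: "z \<in> (+) x ` K \<longleftrightarrow> z - x \<in> (K::'a::euclidean_space set)"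
  by (auto simp: image_iff algebra_simps) (metis diff_add_cancel)

lemma measure_translates_Int:
  "measure lebesgue ((+) x ` K \<inter> (+) y ` K) = overlap K (x - y)"
proof -
  have "(+) x ` K \<inter> (+) y ` K = (+) y ` (K \<inter> (+) (x - y) ` K)"
    by (auto simp: set_eq_iff mem_translate_iff)
  then show ?thesis by (simp add: overlap_def measure_translation)
qed

text \<open>
  The symmetry of the kernel is what allows the roles of a sample point and of a point to be
  illuminated to be exchanged.
\<close>

lemma overlap_sym: "overlap K (x - y) = overlap K (y - x)"
  by (metis measure_translates_Int Int_commute)

lemma overlap_0: "overlap K 0 = measure lebesgue K"
  by (simp add: overlap_def)

lemma overlap_nonneg: "0 \<le> overlap K z"
  by (simp add: overlap_def)

lemma integrable_indicator_lmeasurable: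
  "S \<in> lmeasurable \<Longrightarrow> integrable lebesgue (indicator S :: _ \<Rightarrow> real)"
  by (simp add: lmeasurable_iff_integrable)

lemma translate_subset_double:
  assumes "convex K" "x \<in> K"
  shows "(+) x ` K \<subseteq> (*\<^sub>R) 2 ` (K::'a::euclidean_space set)"
proof
  fix z assume "z \<in> (+) x ` K"
  then obtain k where k: "k \<in> K" "z = x + k" by auto
  have "(1/2) *\<^sub>R x + (1/2) *\<^sub>R k \<in> K"
    using assms k convexD[of K x k "1/2" "1/2"] by auto
  moreover have "z = 2 *\<^sub>R ((1/2) *\<^sub>R x + (1/2) *\<^sub>R k)"
    using k by (simp add: scaleR_add_right)
  ultimately show "z \<in> (*\<^sub>R) 2 ` K" by blast
qed

text \<open>
  The energy is the square integral of \<open>cover\<close>. Since all translates \<open>x + K\<close> with \<open>x \<in> K\<close> lie in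
  \<open>2K\<close>, the function has integral \<open>vol K\<close> over a set of volume \<open>2\<^sup>d vol K\<close>, so its mean there is
  \<open>(1/2)\<^sup>d\<close> and the energy is a variance plus a constant.
\<close>

lemma integral_cover_deviation:
  fixes K :: "'a::euclidean_space set"
  assumes K: "compact K" "convex K" and p: "prob_weights K X p"
  defines "c \<equiv> (1/2) ^ DIM('a) :: real"
  shows "integrable lebesgue (\<lambda>z. (cover K X p z - c * indicator ((*\<^sub>R) 2 ` K) z)\<^sup>2)"
    and "integral\<^sup>L lebesgue (\<lambda>z. (cover K X p z - c * indicator ((*\<^sub>R) 2 ` K) z)\<^sup>2)
      = energy K X p - c * measure lebesgue K"
proof -
  let ?D = "(*\<^sub>R) 2 ` K" and ?T = "\<lambda>x. (+) x ` K"
  have fin: "finite X" and XK: "X \<subseteq> K" and p1: "sum p X = 1"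
    using p by (auto simp: prob_weights_def)
  have T: "?T x \<in> lmeasurable" for x using K by (simp add: measurable_translation lmeasurable_compact)
  have D: "?D \<in> lmeasurable" by (intro lmeasurable_compact compact_scaling K)
  have sub: "?T x \<subseteq> ?D" if "x \<in> X" for x
    using translate_subset_double[OF K(2)] that XK by blast
  have eq: "(cover K X p z - c * indicator ?D z)\<^sup>2 =
     (\<Sum>x\<in>X. \<Sum>y\<in>X. p x * p y * indicator (?T x \<inter> ?T y) z)
      - 2 * c * (\<Sum>x\<in>X. p x * indicator (?T x) z) + c\<^sup>2 * indicator ?D z" for z
  proof -
    have a: "(cover K X p z)\<^sup>2 = (\<Sum>x\<in>X. \<Sum>y\<in>X. p x * p y * indicator (?T x \<inter> ?T y) z)"
      unfolding cover_def power2_eq_square sum_product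
      by (intro sum.cong refl) (auto simp: indicator_def)
    have b: "cover K X p z * indicator ?D z = (\<Sum>x\<in>X. p x * indicator (?T x) z)"
      unfolding cover_def sum_distrib_right
      by (intro sum.cong refl) (use sub in \<open>auto simp: indicator_def\<close>)
    have i: "(indicator ?D z)\<^sup>2 = (indicator ?D z :: real)" by (simp add: indicator_def)
    show ?thesis
      unfolding power2_diff power_mult_distrib a i b[symmetric] by simp
  qed
  have i1: "integrable lebesgue (\<lambda>z. p x * p y * indicator (?T x \<inter> ?T y) z)" for x y
    by (intro integrable_mult_right integrable_indicator_lmeasurable fmeasurable.Int T)
  have i2: "integrable lebesgue (\<lambda>z. p x * indicator (?T x) z)" for x
    by (intro integrable_mult_right integrable_indicator_lmeasurable T)
  have i3: "integrable lebesgue (\<lambda>z. c\<^sup>2 * indicator ?D z)"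
    by (intro integrable_mult_right integrable_indicator_lmeasurable D)
  let ?Q = "\<lambda>z. \<Sum>x\<in>X. \<Sum>y\<in>X. p x * p y * indicator (?T x \<inter> ?T y) z"
  let ?L = "\<lambda>z. \<Sum>x\<in>X. p x * indicator (?T x) z"
  have iQ: "integrable lebesgue ?Q"
    by (intro Bochner_Integration.integrable_sum i1)
  have iL: "integrable lebesgue ?L"
    by (intro Bochner_Integration.integrable_sum i2)
  show "integrable lebesgue (\<lambda>z. (cover K X p z - c * indicator ?D z)\<^sup>2)"
    unfolding eq
    by (intro Bochner_Integration.integrable_add Bochner_Integration.integrable_diff
        integrable_mult_right iQ iL i3)
  have m: "measure lebesgue ((?T x \<inter> ?T y) \<inter> space lebesgue) = overlap K (x - y)" for x y
    by (simp add: measure_translates_Int)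
  have s1: "integral\<^sup>L lebesgue ?Q = energy K X p"
  proof -
    have "integral\<^sup>L lebesgue ?Q
        = (\<Sum>x\<in>X. \<Sum>y\<in>X. integral\<^sup>L lebesgue (\<lambda>z. p x * p y * indicator (?T x \<inter> ?T y) z))"
      using i1 by (simp only: Bochner_Integration.integral_sum Bochner_Integration.integrable_sum)
    also have "\<dots> = (\<Sum>x\<in>X. \<Sum>y\<in>X. p x * p y * overlap K (x - y))"
      by (simp only: integral_mult_right_zero Bochner_Integration.integral_indicator m)
    finally show ?thesis
      by (simp add: energy_def potential_def sum_distrib_left mult.assoc)
  qed
  have s2: "integral\<^sup>L lebesgue ?L = measure lebesgue K"
  proof -
    have "integral\<^sup>L lebesgue ?L = (\<Sum>x\<in>X. integral\<^sup>L lebesgue (\<lambda>z. p x * indicator (?T x) z))"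
      using i2 by (simp only: Bochner_Integration.integral_sum)
    also have "\<dots> = (\<Sum>x\<in>X. p x * measure lebesgue K)"
      by (simp add: measure_translation)
    finally show ?thesis by (simp add: p1 flip: sum_distrib_right)
  qed
  have s3: "integral\<^sup>L lebesgue (indicator ?D) = 2 ^ DIM('a) * measure lebesgue K"
    by (simp add: measure_scaleR_image)
  have "integral\<^sup>L lebesgue (\<lambda>z. (cover K X p z - c * indicator ?D z)\<^sup>2)
     = integral\<^sup>L lebesgue ?Q - 2 * c * integral\<^sup>L lebesgue ?L
       + c\<^sup>2 * integral\<^sup>L lebesgue (indicator ?D)"
    unfolding eq
    using iQ iL i3
    by (simp only: Bochner_Integration.integral_add Bochner_Integration.integral_diff
       Bochner_Integration.integrable_diff integrable_mult_right integral_mult_right_zero)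
  also have "\<dots> = energy K X p - c * measure lebesgue K"
    unfolding s1 s2 s3 by (simp add: c_def power2_eq_square power_one_over)
  finally show "integral\<^sup>L lebesgue (\<lambda>z. (cover K X p z - c * indicator ?D z)\<^sup>2)
      = energy K X p - c * measure lebesgue K" .
qed

lemma energy_lower_bound:
  fixes K :: "'a::euclidean_space set"
  assumes K: "compact K" "convex K" and p: "prob_weights K X p"
  shows "(1/2) ^ DIM('a) * measure lebesgue K \<le> energy K X p"
proof -
  have "0 \<le> integral\<^sup>L lebesgue
      (\<lambda>z. (cover K X p z - (1/2) ^ DIM('a) * indicator ((*\<^sub>R) 2 ` K) z)\<^sup>2)"
    by (rule Bochner_Integration.integral_nonneg) simp
  then show ?thesis
    unfolding integral_cover_deviation(2)[OF assms] by simp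
qed

definition min_energy :: "'a::euclidean_space set \<Rightarrow> real" where
  "min_energy K = Inf {energy K X p |X p. prob_weights K X p}"

lemma prob_weights_single: "x \<in> K \<Longrightarrow> prob_weights K {x} (\<lambda>_. 1)"
  by (simp add: prob_weights_def)

lemma bdd_below_energy:
  fixes K :: "'a::euclidean_space set"
  assumes K: "compact K" "convex K"
  shows "bdd_below {energy K X p |X p. prob_weights K X p}"
  by (rule bdd_belowI[of _ "(1/2) ^ DIM('a) * measure lebesgue K"])
    (auto intro: energy_lower_bound[OF assms])

lemma min_energy_le:
  assumes "compact K" "convex K" "prob_weights K X p"
  shows "min_energy K \<le> energy K X p"
  unfolding min_energy_def using assms by (intro cInf_lower bdd_below_energy) auto

lemma min_energy_ge:
  fixes K :: "'a::euclidean_space set"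
  assumes K: "compact K" "convex K" "K \<noteq> {}"
  shows "(1/2) ^ DIM('a) * measure lebesgue K \<le> min_energy K"
proof -
  obtain x where "x \<in> K" using K(3) by blast
  then have "\<exists>X p. prob_weights K X p"
    by (intro exI[of _ "{x}"] exI[of _ "\<lambda>_. 1"] prob_weights_single)
  then show ?thesis
    unfolding min_energy_def
    by (intro cInf_greatest) (auto intro: energy_lower_bound[OF K(1,2)])
qed

text \<open>
  First order optimality. If moving a proportion \<open>t\<close> of the mass to \<open>x\<close> cannot lower the energy by more
  than the available slack, then the potential at \<open>x\<close> is almost at least the energy: the derivative
  of the energy in this direction is twice the difference of the two. Only near minimisers are available because the
  support is finite but otherwise unrestricted, so \<open>t\<close> plays the part of the step length and the slack
  is its square.
\<close>

lemma potential_nearly_ge: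
  fixes K :: "'a::euclidean_space set"
  assumes K: "compact K" "convex K" and p: "prob_weights K X p" and x: "x \<in> K"
    and t: "0 < t" "t \<le> 1" and near: "energy K X p \<le> min_energy K + t\<^sup>2"
  shows "min_energy K - t * (1 + measure lebesgue K) \<le> potential K X p x"
proof -
  let ?h = "overlap K" and ?v = "measure lebesgue K"
  have fin: "finite X" and XK: "X \<subseteq> K" and p1: "sum p X = 1" and p0: "\<And>x. x \<in> X \<Longrightarrow> 0 \<le> p x"
    using p by (auto simp: prob_weights_def)
  \<comment> \<open>The perturbed measure \<open>r\<close> is supported in \<open>Y\<close>; the point \<open>x\<close> may or may not belong to \<open>X\<close>.\<close>
  define Y where "Y = insert x X"
  define p' where "p' y = (if y \<in> X then p y else 0)" for y
  define d where "d y = (if y = x then 1 else 0 :: real)" for y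
  define r where "r y = (1 - t) * p' y + t * d y" for y
  have Y: "finite Y" "X \<subseteq> Y" "x \<in> Y" using fin by (auto simp: Y_def)
  have sp: "(\<Sum>y\<in>Y. p' y * f y) = (\<Sum>y\<in>X. p y * f y)" for f :: "'a \<Rightarrow> real"
    using Y by (intro sum.mono_neutral_cong_right) (auto simp: p'_def)
  have sd: "(\<Sum>y\<in>Y. d y * f y) = f x" for f :: "'a \<Rightarrow> real"
    using Y by (simp add: d_def if_distrib[of "\<lambda>u. u * _"] cong: if_cong)
  have sr: "(\<Sum>y\<in>Y. r y * f y) = (1 - t) * (\<Sum>y\<in>X. p y * f y) + t * f x" for f :: "'a \<Rightarrow> real"
  proof -
    have "(\<Sum>y\<in>Y. r y * f y) = (\<Sum>y\<in>Y. (1 - t) * (p' y * f y) + t * (d y * f y))"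
      by (simp add: r_def algebra_simps)
    then show ?thesis
      by (simp add: sum.distrib sp sd flip: sum_distrib_left)
  qed
  have "prob_weights K Y r"
    using sr[of "\<lambda>_. 1"] Y XK x t p0 p1
    by (auto simp: prob_weights_def Y_def r_def p'_def d_def)
  then have ge: "min_energy K \<le> energy K Y r"
    by (intro min_energy_le K)
  have pot: "potential K Y r y = (1 - t) * potential K X p y + t * ?h (y - x)" for y
    unfolding potential_def by (rule sr)
  have hx: "(\<Sum>y\<in>X. p y * ?h (y - x)) = potential K X p x"
    unfolding potential_def by (simp add: overlap_sym[of K x])
  have "energy K Y r = (1 - t) * (\<Sum>y\<in>X. p y * ((1 - t) * potential K X p y + t * ?h (y - x)))
     + t * ((1 - t) * potential K X p x + t * ?v)"
    unfolding energy_def pot sr by (simp add: overlap_0)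
  also have "(\<Sum>y\<in>X. p y * ((1 - t) * potential K X p y + t * ?h (y - x)))
      = (1 - t) * energy K X p + t * potential K X p x"
  proof -
    have "(\<Sum>y\<in>X. p y * ((1 - t) * potential K X p y + t * ?h (y - x)))
       = (\<Sum>y\<in>X. (1 - t) * (p y * potential K X p y) + t * (p y * ?h (y - x)))"
      by (simp add: algebra_simps)
    then show ?thesis
      by (simp add: sum.distrib energy_def flip: hx sum_distrib_left)
  qed
  finally have e: "energy K Y r = (1 - t)\<^sup>2 * energy K X p
      + 2 * t * (1 - t) * potential K X p x + t\<^sup>2 * ?v"
    by (simp add: power2_eq_square algebra_simps)
  have q0: "0 \<le> potential K X p x"
    unfolding potential_def by (intro sum_nonneg mult_nonneg_nonneg p0 overlap_nonneg)
  have m0: "0 \<le> min_energy K"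
  proof -
    have "0 \<le> (1/2) ^ DIM('a) * ?v" by simp
    also have "\<dots> \<le> min_energy K" using min_energy_ge[OF K] x by blast
    finally show ?thesis .
  qed
  have "min_energy K \<le> (1 - t)\<^sup>2 * (min_energy K + t\<^sup>2) + 2 * t * (1 - t) * potential K X p x + t\<^sup>2 * ?v"
    using ge near mult_left_mono[OF near, of "(1 - t)\<^sup>2"] unfolding e by simp
  moreover have "(1 - t)\<^sup>2 * t\<^sup>2 \<le> t\<^sup>2"
    using t by (intro mult_left_le_one_le) (auto simp: power_le_one)
  moreover have "2 * t * (1 - t) * potential K X p x \<le> 2 * t * potential K X p x"
    using t q0 by (intro mult_right_mono) (auto simp: mult_left_le)
  ultimately have "2 * t * min_energy K \<le> t\<^sup>2 * min_energy K + t\<^sup>2 + 2 * t * potential K X p x + t\<^sup>2 * ?v"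
    by (simp add: power2_eq_square algebra_simps)
  then have "t * (2 * min_energy K) \<le> t * (t * min_energy K + t + 2 * potential K X p x + t * ?v)"
    by (simp add: power2_eq_square algebra_simps)
  then have a: "2 * min_energy K \<le> t * min_energy K + t + 2 * potential K X p x + t * ?v"
    using t by simp
  have "min_energy K \<le> ?v"
  proof -
    have "energy K {x} (\<lambda>_. 1) = ?v" by (simp add: energy_def potential_def overlap_0)
    then show ?thesis
      using min_energy_le[OF K prob_weights_single[OF x]] by simp
  qed
  then have "t * min_energy K \<le> t * ?v" using t by simp
  with a show ?thesis using t unfolding distrib_left mult_1_right by linarith
qed

section \<open>Fractional illumination from a law on translations\<close>

text \<open>
  Families indexed by an arbitrary finite set are more convenient than the initial segments of
  \<open>nat\<close> used in the definition.
\<close>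

lemma illumination_number_le:
  fixes K :: "(real ^ 'n) set"
  assumes I: "finite I" and u: "\<And>i. i \<in> I \<Longrightarrow> norm (u i) = 1" and w: "\<And>i. i \<in> I \<Longrightarrow> 0 \<le> w i"
    and cov: "\<And>y. y \<in> frontier K \<Longrightarrow> 1 \<le> (\<Sum>i\<in>{i\<in>I. illuminates K (u i) y}. w i)"
  shows "fractional_illumination_number K \<le> ereal (sum w I)"
proof -
  obtain h where h: "bij_betw h {..<card I} I"
    using ex_bij_betw_nat_finite[OF I] by (auto simp: atLeast0LessThan)
  have s: "(\<Sum>j\<in>{j. j < card I \<and> illuminates K (u (h j)) y}. w (h j))
       = (\<Sum>i\<in>{i\<in>I. illuminates K (u i) y}. w i)" for y
  proof (rule sum.reindex_bij_betw)
    have "h ` {j. j < card I \<and> illuminates K (u (h j)) y} = {i\<in>I. illuminates K (u i) y}"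
      using h by (force simp: bij_betw_def)
    then show "bij_betw h {j. j < card I \<and> illuminates K (u (h j)) y} {i\<in>I. illuminates K (u i) y}"
      using h by (auto simp: bij_betw_def inj_on_def)
  qed
  have "fractional_illumination K (card I) (u \<circ> h) (w \<circ> h)"
    using bij_betwE[OF h] u w cov by (simp add: fractional_illumination_def s)
  then have "fractional_illumination_number K \<le> ereal (\<Sum>j<card I. (w \<circ> h) j)"
    unfolding fractional_illumination_number_def by (intro Inf_lower) blast
  also have "(\<Sum>j<card I. (w \<circ> h) j) = sum w I"
    unfolding comp_def by (rule sum.reindex_bij_betw[OF h])
  finally show ?thesis .
qed

text \<open>
  Directions that behave alike on a finite net will be merged; this says that no weight is lost.
\<close>

lemma sum_measure_patterns:
  fixes A :: "'i \<Rightarrow> 'a::euclidean_space set"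
  assumes K: "K \<in> lmeasurable" and N: "finite N" and A: "\<And>x. x \<in> N \<Longrightarrow> A x \<in> sets lebesgue"
    and P: "\<And>S. P S \<Longrightarrow> S \<subseteq> N"
  shows "(\<Sum>S | P S. measure lebesgue {k\<in>K. {x\<in>N. k \<in> A x} = S})
       = measure lebesgue {k\<in>K. P {x\<in>N. k \<in> A x}}"
proof -
  let ?M = "\<lambda>S. {k\<in>K. {x\<in>N. k \<in> A x} = S}"
  have fin: "finite {S. P S}"
    by (rule finite_subset[of _ "Pow N"]) (use N P in auto)
  have M: "?M S \<in> lmeasurable" if "P S" for S
  proof -
    have "?M S = K \<inter> {k \<in> space lebesgue. \<forall>x\<in>N. (k \<in> A x) = (x \<in> S)}"
      using P[OF that] by auto
    moreover have "{k \<in> space lebesgue. \<forall>x\<in>N. (k \<in> A x) = (x \<in> S)} \<in> sets lebesgue"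
    proof (rule sets.sets_Collect_finite_All[OF _ N])
      fix x assume "x \<in> N"
      then have "A x \<in> sets lebesgue" "- A x \<in> sets lebesgue"
        using A by (auto simp: Compl_in_sets_lebesgue)
      moreover have "{k \<in> space lebesgue. (k \<in> A x) = (x \<in> S)} = (if x \<in> S then A x else - A x)"
        by auto
      ultimately show "{k \<in> space lebesgue. (k \<in> A x) = (x \<in> S)} \<in> sets lebesgue" by simp
    qed
    ultimately show ?thesis using K by (simp add: fmeasurable_Int_fmeasurable)
  qed
  have "(\<Sum>S | P S. measure lebesgue (?M S)) = measure lebesgue (\<Union>S\<in>{S. P S}. ?M S)"
    using fin M fmeasurableD2[OF M] by (intro measure_finite_Union[symmetric])
      (auto simp: disjoint_family_on_def fmeasurableD simp del: emeasure_completion)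
  also have "(\<Union>S\<in>{S. P S}. ?M S) = {k\<in>K. P {x\<in>N. k \<in> A x}}" by auto
  finally show ?thesis .
qed

text \<open>
  Slightly shrunk copies of the body leave room for a uniform margin: a direction that moves \<open>x\<close> into
  the copy also illuminates all neighbours of \<open>x\<close>.
\<close>

definition shrink :: "'a::real_vector \<Rightarrow> real \<Rightarrow> 'a set \<Rightarrow> 'a set" where
  "shrink c t K = (\<lambda>x. c + (1 - t) *\<^sub>R (x - c)) ` K"

lemma shrink_subset:
  assumes "convex K" "c \<in> K" "0 \<le> t" "t \<le> 1"
  shows "shrink c t K \<subseteq> K"
proof
  fix z assume "z \<in> shrink c t K"
  then obtain x where x: "x \<in> K" "z = c + (1 - t) *\<^sub>R (x - c)" by (auto simp: shrink_def)
  then have "z = t *\<^sub>R c + (1 - t) *\<^sub>R x" by (simp add: algebra_simps)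
  then show "z \<in> K" using convexD[OF assms(1,2) x(1), of t "1 - t"] assms by auto
qed

lemma ball_shrink_subset:
  fixes K :: "'a::real_normed_vector set"
  assumes K: "convex K" and c: "ball c r \<subseteq> K" and t: "0 < t" "t \<le> 1" and y: "y \<in> shrink c t K"
  shows "ball y (t * r) \<subseteq> K"
proof
  fix z assume z: "z \<in> ball y (t * r)"
  obtain x where x: "x \<in> K" "y = c + (1 - t) *\<^sub>R (x - c)" using y by (auto simp: shrink_def)
  define b where "b = c + (1/t) *\<^sub>R (z - y)"
  have "norm (z - y) < t * r" using z by (simp add: dist_norm norm_minus_commute)
  then have "b \<in> ball c r"
    using t by (simp add: b_def dist_norm norm_minus_commute pos_divide_less_eq mult.commute)
  then have "b \<in> K" using c by blast
  then have "t *\<^sub>R b + (1 - t) *\<^sub>R x \<in> K" using convexD[OF K _ x(1), of b t "1 - t"] t by auto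
  also have "t *\<^sub>R b + (1 - t) *\<^sub>R x = z" using t by (simp add: b_def x(2) algebra_simps)
  finally show "z \<in> K" .
qed

text \<open>
  Let \<open>k\<close> be uniform in \<open>K\<close> and let \<open>x'\<close> be a random point of \<open>X\<close> with law \<open>p\<close>. The direction \<open>k - x'\<close>
  moves a point \<open>x\<close> into \<open>K\<close> with probability \<open>potential K X p x / vol K\<close>, by the symmetry of the
  overlap. Two roundings turn this law into a finite family. A finite net \<open>N\<close> replaces the boundary,
  which costs the passage to the shrunk body, and directions with the same pattern of served net points
  are merged into one representative. The constant \<open>\<gamma>\<close> is what the shrinking leaves of the lower
  bound \<open>\<beta>\<close>.
\<close>

lemma illumination_number_le_potential:
  fixes K :: "(real ^ 'n) set"
  assumes K: "compact K" "convex K" "ball c r \<subseteq> K" "0 < r" and t: "0 < t" "t \<le> 1"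
    and p: "prob_weights K X p" and pot: "\<And>x. x \<in> K \<Longrightarrow> \<beta> \<le> potential K X p x"
    and \<gamma>: "\<gamma> = \<beta> - (1 - (1 - t) ^ CARD('n)) * measure lebesgue K" "0 < \<gamma>"
  shows "fractional_illumination_number K \<le> ereal (measure lebesgue K / \<gamma>)"
proof -
  let ?Kt = "shrink c t K" and ?v = "measure lebesgue K"
  have fin: "finite X" and XK: "X \<subseteq> K" and p1: "sum p X = 1" and p0: "\<And>x. x \<in> X \<Longrightarrow> 0 \<le> p x"
    using p by (auto simp: prob_weights_def)
  have cK: "c \<in> K" using K(3,4) by auto
  have Kt: "compact ?Kt" unfolding shrink_def
    by (intro compact_continuous_image continuous_intros K)
  have KtK: "?Kt \<subseteq> K" using shrink_subset[OF K(2) cK] t by auto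
  have Km: "K \<in> lmeasurable" and Ktm: "?Kt \<in> lmeasurable"
    using K Kt by (auto simp: lmeasurable_compact)
  have vKt: "measure lebesgue ?Kt = (1 - t) ^ CARD('n) * ?v"
    using t by (simp add: shrink_def measure_homothety)
  have fK: "frontier K \<subseteq> K" using K(1) by (simp add: compact_imp_closed frontier_subset_closed)
  have "compact (frontier K)" using K(1) by (rule compact_frontier)
  then obtain N where N: "finite N" "N \<subseteq> frontier K" and net: "frontier K \<subseteq> (\<Union>x\<in>N. ball x (t * r))"
    by (rule compactE_image[of "frontier K" "frontier K" "\<lambda>x. ball x (t * r)"])
       (use t K(4) in auto)
  define A where "A x' x = (+) (x' - x) ` ?Kt" for x' x
  have A_iff: "k \<in> A x' x \<longleftrightarrow> x + (k - x') \<in> ?Kt" for k x' x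
    unfolding A_def mem_translate_iff by (simp add: algebra_simps)
  have Am: "A x' x \<in> lmeasurable" for x' x
    unfolding A_def by (intro measurable_translation Ktm)
  define M where "M x' S = {k\<in>K. {x\<in>N. k \<in> A x' x} = S}" for x' S
  define I where "I = X \<times> Pow N"
  define w where "w = (\<lambda>(x',S). p x' * measure lebesgue (M x' S) / \<gamma>)"
  \<comment> \<open>The vector \<open>axis undefined 1\<close> only keeps the direction a unit vector when the pattern is not realised.\<close>
  define u where "u = (\<lambda>(x',S). let v = (SOME k. k \<in> M x' S) - x' in
      if v = 0 then axis undefined 1 else sgn v :: real ^ 'n)"
  have Ifin: "finite I" unfolding I_def using fin N by simp
  have u1: "norm (u i) = 1" for i
    by (cases i) (simp add: u_def Let_def norm_sgn)
  have w0: "0 \<le> w i" if "i \<in> I" for i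
    using that p0 \<gamma>(2) by (auto simp: w_def I_def)
  have sub: "overlap K (x' - x) \<le> measure lebesgue (K \<inter> A x' x) + (?v - measure lebesgue ?Kt)" for x x'
  proof -
    let ?T = "(+) (x' - x)"
    have s: "K \<inter> ?T ` K \<subseteq> (K \<inter> A x' x) \<union> ?T ` (K - ?Kt)"
      by (auto simp: A_def)
    have m: "?T ` (K - ?Kt) \<in> lmeasurable" "K \<inter> A x' x \<in> lmeasurable"
      by (intro measurable_translation fmeasurable.Diff fmeasurable.Int Km Ktm Am)+
    have "overlap K (x' - x) \<le> measure lebesgue ((K \<inter> A x' x) \<union> ?T ` (K - ?Kt))"
      unfolding overlap_def using m s Km
      by (intro measure_mono_fmeasurable fmeasurable.Un)
         (auto intro!: fmeasurableD fmeasurable.Int measurable_translation)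
    also have "\<dots> \<le> measure lebesgue (K \<inter> A x' x) + measure lebesgue (?T ` (K - ?Kt))"
      using m by (intro measure_Un_le) (auto simp: fmeasurableD)
    also have "measure lebesgue (?T ` (K - ?Kt)) = ?v - measure lebesgue ?Kt"
      using KtK Km Ktm by (simp add: measure_translation measurable_measure_Diff fmeasurableD)
    finally show ?thesis by simp
  qed
  have total: "(\<Sum>S | S \<subseteq> N. measure lebesgue (M x' S)) = ?v" for x'
  proof -
    have "(\<Sum>S | S \<subseteq> N. measure lebesgue (M x' S)) = measure lebesgue {k\<in>K. {z\<in>N. k \<in> A x' z} \<subseteq> N}"
      unfolding M_def using N Am Km by (intro sum_measure_patterns) (auto simp: fmeasurableD)
    also have "{k\<in>K. {z\<in>N. k \<in> A x' z} \<subseteq> N} = K" by auto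
    finally show ?thesis .
  qed
  have "fractional_illumination_number K \<le> ereal (sum w I)"
  proof (rule illumination_number_le[OF Ifin u1 w0])
    fix y assume y: "y \<in> frontier K"
    then obtain x where x: "x \<in> N" "y \<in> ball x (t * r)" using net by blast
    have xK: "x \<in> K" using x N fK by blast
    have ill: "illuminates K (u (x',S)) y" if S: "x \<in> S" "M x' S \<noteq> {}" for x' S
    proof -
      define k where "k = (SOME k. k \<in> M x' S)"
      have "k \<in> M x' S" unfolding k_def using S(2) some_in_eq by blast
      then have "x + (k - x') \<in> ?Kt" using S(1) by (auto simp: M_def A_iff)
      then have "ball (x + (k - x')) (t * r) \<subseteq> K"
        by (rule ball_shrink_subset[OF K(2,3) t])
      then have "ball (x + (k - x')) (t * r) \<subseteq> interior K"
        by (simp add: interior_maximal)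
      moreover have "y + (k - x') \<in> ball (x + (k - x')) (t * r)" using x(2) by (simp add: dist_norm)
      ultimately have int: "y + (k - x') \<in> interior K" by blast
      have ne: "k - x' \<noteq> 0"
      proof
        assume "k - x' = 0" then show False using int y by (simp add: frontier_def)
      qed
      then have "u (x',S) = sgn (k - x')" by (simp add: u_def Let_def k_def)
      then have "y + norm (k - x') *\<^sub>R u (x',S) = y + (k - x')"
        using ne by (simp add: sgn_div_norm)
      then show ?thesis unfolding illuminates_def using int ne by (metis zero_less_norm_iff)
    qed
    have "\<beta> \<le> (\<Sum>x'\<in>X. p x' * overlap K (x' - x))"
      using pot[OF xK] unfolding potential_def by (simp add: overlap_sym[of K x])
    also have "\<dots> \<le> (\<Sum>x'\<in>X. p x' * (measure lebesgue (K \<inter> A x' x) + (?v - measure lebesgue ?Kt)))"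
      by (intro sum_mono mult_left_mono sub p0)
    also have "\<dots> = (\<Sum>x'\<in>X. p x' * measure lebesgue (K \<inter> A x' x)) + (?v - measure lebesgue ?Kt)"
      by (simp add: distrib_left sum.distrib p1 flip: sum_distrib_right)
    finally have "\<gamma> \<le> (\<Sum>x'\<in>X. p x' * measure lebesgue (K \<inter> A x' x))"
      unfolding \<gamma>(1) vKt by (simp add: algebra_simps)
    also have "\<dots> = (\<Sum>x'\<in>X. p x' * (\<Sum>S | S \<subseteq> N \<and> x \<in> S. measure lebesgue (M x' S)))"
    proof (intro sum.cong refl arg_cong[of _ _ "(*) _"])
      fix x'
      have "(\<Sum>S | S \<subseteq> N \<and> x \<in> S. measure lebesgue (M x' S))
          = measure lebesgue {k\<in>K. {z\<in>N. k \<in> A x' z} \<subseteq> N \<and> x \<in> {z\<in>N. k \<in> A x' z}}"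
        unfolding M_def using N Am Km by (intro sum_measure_patterns) (auto simp: fmeasurableD)
      also have "{k\<in>K. {z\<in>N. k \<in> A x' z} \<subseteq> N \<and> x \<in> {z\<in>N. k \<in> A x' z}} = K \<inter> A x' x"
        using x(1) by auto
      finally show "measure lebesgue (K \<inter> A x' x) = (\<Sum>S | S \<subseteq> N \<and> x \<in> S. measure lebesgue (M x' S))"
        by simp
    qed
    also have "\<dots> = (\<Sum>(x',S)\<in>X \<times> {S. S \<subseteq> N \<and> x \<in> S}. p x' * measure lebesgue (M x' S))"
      by (simp add: sum_distrib_left sum.cartesian_product)
    also have "\<dots> = \<gamma> * sum w (X \<times> {S. S \<subseteq> N \<and> x \<in> S})"
      using \<gamma>(2) by (simp add: sum_distrib_left w_def case_prod_unfold)
    also have "sum w (X \<times> {S. S \<subseteq> N \<and> x \<in> S})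
        = sum w {i\<in>X \<times> {S. S \<subseteq> N \<and> x \<in> S}. M (fst i) (snd i) \<noteq> {}}"
      using finite_subset[of "X \<times> {S. S \<subseteq> N \<and> x \<in> S}" I] Ifin
      by (intro sum.mono_neutral_right) (auto simp: I_def w_def)
    also have "\<gamma> * \<dots> \<le> \<gamma> * sum w {i\<in>I. illuminates K (u i) y}"
      using \<gamma>(2) Ifin w0 ill
      by (intro mult_left_mono sum_mono2) (fastforce simp: I_def)+
    finally show "1 \<le> (\<Sum>i\<in>{i\<in>I. illuminates K (u i) y}. w i)"
      using \<gamma>(2) by simp
  qed
  also have "sum w I = (\<Sum>x'\<in>X. p x' * (\<Sum>S | S \<subseteq> N. measure lebesgue (M x' S))) / \<gamma>"
    by (simp add: I_def w_def sum.cartesian_product[symmetric] Pow_def sum_distrib_left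
        sum_divide_distrib)
  also have "\<dots> = ?v / \<gamma>"
    by (simp add: total p1 flip: sum_distrib_right)
  finally show ?thesis .
qed

lemma convex_body_measure_pos:
  fixes K :: "'a::euclidean_space set"
  assumes "compact K" "interior K \<noteq> {}"
  shows "0 < measure lebesgue K"
proof -
  have "\<not> negligible K"
    using assms(2) by (metis interior_subset negligible_subset open_interior open_not_negligible)
  then show ?thesis
    using assms(1) lmeasurable_compact negligible_iff_measure0 zero_less_measure_iff by blast
qed

text \<open>
  The step length \<open>t\<close> of the perturbation is also used as the shrinking parameter; both losses vanish
  as it tends to \<open>0\<close>.
\<close>

lemma illumination_number_le_min_energy:
  fixes K :: "(real ^ 'n) set"
  assumes K: "compact K" "convex K" "interior K \<noteq> {}"
  shows "fractional_illumination_number K \<le> ereal (measure lebesgue K / min_energy K)"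
proof -
  let ?v = "measure lebesgue K" and ?m = "min_energy K"
  have v: "0 < ?v" using convex_body_measure_pos K by blast
  have "K \<noteq> {}" using K(3) by auto
  then have m: "0 < ?m"
    using min_energy_ge[OF K(1,2)] v by (smt (verit) mult_pos_pos zero_less_power half_gt_zero_iff)
  obtain c r where cr: "ball c r \<subseteq> K" "0 < r" using K(3) by (meson equals0I mem_interior)
  define g where "g t = ?m - t * (1 + ?v) - (1 - (1 - t) ^ CARD('n)) * ?v" for t
  have lim: "(g \<longlongrightarrow> ?m) (at_right 0)"
    unfolding g_def by (rule tendsto_eq_intros refl | simp)+
  have ev: "\<forall>\<^sub>F t in at_right 0. fractional_illumination_number K \<le> ereal (?v / g t)"
  proof -
    have "\<forall>\<^sub>F t in at_right (0::real). 0 < t \<and> t < 1"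
      using eventually_at_right_real[of 0 1] by (auto elim: eventually_mono)
    moreover have "\<forall>\<^sub>F t in at_right 0. 0 < g t"
      using order_tendstoD(1)[OF lim m] .
    ultimately show ?thesis
    proof eventually_elim
      case (elim t)
      have "\<exists>X p. prob_weights K X p \<and> energy K X p < ?m + t\<^sup>2"
      proof -
        obtain x where "x \<in> K" using \<open>K \<noteq> {}\<close> by blast
        then have "{energy K X p |X p. prob_weights K X p} \<noteq> {}"
          using prob_weights_single[of x K] by (metis (mono_tags, lifting) empty_iff mem_Collect_eq)
        from cInf_lessD[OF this, of "?m + t\<^sup>2"] show ?thesis
          using elim by (auto simp: min_energy_def)
      qed
      then obtain X p where p: "prob_weights K X p" "energy K X p < ?m + t\<^sup>2" by blast
      have "?m - t * (1 + ?v) \<le> potential K X p x" if "x \<in> K" for x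
        using potential_nearly_ge[OF K(1,2) p(1) that] elim p(2) by auto
      then show ?case
        using illumination_number_le_potential[OF K(1,2) cr _ _ p(1), of t "?m - t * (1 + ?v)" "g t"]
          elim by (simp add: g_def)
    qed
  qed
  have "((\<lambda>t. ereal (?v / g t)) \<longlongrightarrow> ereal (?v / ?m)) (at_right 0)"
    using m by (intro tendsto_intros lim) auto
  then show ?thesis
    by (rule tendsto_lowerbound[OF _ ev]) simp
qed

lemma illumination_number_le_two_power:
  fixes K :: "(real ^ 'n) set"
  assumes K: "compact K" "convex K" "interior K \<noteq> {}"
  shows "fractional_illumination_number K \<le> 2 ^ CARD('n)"
    and "fractional_illumination_number K = 2 ^ CARD('n) \<Longrightarrow>
      min_energy K = (1/2) ^ CARD('n) * measure lebesgue K"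
proof -
  let ?v = "measure lebesgue K" and ?m = "min_energy K"
  have v: "0 < ?v" using convex_body_measure_pos K by blast
  have "K \<noteq> {}" using K(3) by auto
  then have m: "(1/2) ^ CARD('n) * ?v \<le> ?m" using min_energy_ge[OF K(1,2)] by simp
  have m0: "0 < ?m" using m v by (smt (verit) mult_pos_pos zero_less_power half_gt_zero_iff)
  have le: "?v / ?m \<le> 2 ^ CARD('n)"
    using m m0 by (simp add: field_simps power_one_over)
  have I: "fractional_illumination_number K \<le> ereal (?v / ?m)"
    by (rule illumination_number_le_min_energy[OF K])
  have e: "(2::ereal) ^ CARD('n) = ereal (2 ^ CARD('n))"
    by (simp flip: ereal_power)
  show "fractional_illumination_number K \<le> 2 ^ CARD('n)"
    using I le unfolding e by (meson ereal_less_eq(3) order_trans)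
  show "?m = (1/2) ^ CARD('n) * ?v" if "fractional_illumination_number K = 2 ^ CARD('n)"
  proof -
    have "2 ^ CARD('n) \<le> ?v / ?m" using I unfolding that e by simp
    then show ?thesis using m m0 by (simp add: field_simps power_one_over)
  qed
qed

section \<open>Minimal energy forces a tiling by vertex translates\<close>

definition mass :: "'a set \<Rightarrow> ('a \<Rightarrow> real) \<Rightarrow> 'a set \<Rightarrow> real" where
  "mass X p A = sum p (X \<inter> A)"

lemma mass_mono:
  "prob_weights K X p \<Longrightarrow> X \<inter> A \<subseteq> B \<Longrightarrow> mass X p A \<le> mass X p B"
  unfolding mass_def prob_weights_def by (intro sum_mono2) auto

lemma mass_Un_disjoint:
  "prob_weights K X p \<Longrightarrow> A \<inter> B = {} \<Longrightarrow> mass X p (A \<union> B) = mass X p A + mass X p B"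
  unfolding mass_def prob_weights_def Int_Un_distrib by (intro sum.union_disjoint) auto

lemma mass_UN_le:
  assumes "prob_weights K X p" "finite I"
  shows "mass X p (\<Union>i\<in>I. A i) \<le> (\<Sum>i\<in>I. mass X p (A i))"
  using assms(2)
proof (induction I)
  case empty then show ?case by (simp add: mass_def)
next
  case (insert i I)
  have fin: "finite X" and p0: "\<And>x. x \<in> X \<Longrightarrow> 0 \<le> p x"
    using assms by (auto simp: prob_weights_def)
  have "mass X p (A i \<union> (\<Union>j\<in>I. A j)) \<le> mass X p (A i) + mass X p (\<Union>j\<in>I. A j)"
    unfolding mass_def Int_Un_distrib
    using fin p0 sum.union_inter[of "X \<inter> A i" "X \<inter> (\<Union>j\<in>I. A j)" p]
      sum_nonneg[of "(X \<inter> A i) \<inter> (X \<inter> (\<Union>j\<in>I. A j))" p] by fastforce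
  then show ?case using insert by simp
qed

lemma mass_UN_disjoint:
  assumes "prob_weights K X p" "finite I" "disjoint_family_on A I"
  shows "(\<Sum>i\<in>I. mass X p (A i)) \<le> 1"
proof -
  have fin: "finite X" and p0: "\<And>x. x \<in> X \<Longrightarrow> 0 \<le> p x" and p1: "sum p X = 1"
    using assms by (auto simp: prob_weights_def)
  have "(\<Sum>i\<in>I. mass X p (A i)) = sum p (\<Union>i\<in>I. X \<inter> A i)"
    unfolding mass_def using assms fin
    by (intro sum.UNION_disjoint[symmetric]) (auto simp: disjoint_family_on_def)
  also have "\<dots> \<le> sum p X" by (intro sum_mono2) (use fin p0 in auto)
  finally show ?thesis using p1 by simp
qed

lemma mass_body: "prob_weights K X p \<Longrightarrow> K \<subseteq> A \<Longrightarrow> mass X p A = 1"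
  unfolding mass_def prob_weights_def by (metis inf.absorb1 subset_trans)

lemma cover_eq_mass:
  assumes "prob_weights K X p"
  shows "cover K X p z = mass X p {x. z - x \<in> K}"
proof -
  have "cover K X p z = (\<Sum>x\<in>X. if x \<in> {x. z - x \<in> K} then p x else 0)"
    unfolding cover_def by (intro sum.cong refl) (auto simp: indicator_def mem_translate_iff)
  also have "\<dots> = mass X p {x. z - x \<in> K}"
    unfolding mass_def using assms by (subst sum.inter_restrict) (auto simp: prob_weights_def)
  finally show ?thesis .
qed

text \<open>
  The trace that minimal energy leaves: in any prescribed finite list of open tests inside \<open>2K\<close>, a suitable
  measure has \<open>cover\<close> close to \<open>(1/2)\<^sup>d\<close> somewhere. Working with finitely many tests at a time
  avoids the passage to a limit measure.
\<close>

definition evenly_covered :: "'a::euclidean_space set \<Rightarrow> bool" where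
  "evenly_covered K \<longleftrightarrow> (\<forall>\<U> \<eta>. finite \<U> \<longrightarrow> (\<forall>U\<in>\<U>. open U \<and> U \<noteq> {} \<and> U \<subseteq> (*\<^sub>R) 2 ` K) \<longrightarrow> \<eta> > 0 \<longrightarrow>
     (\<exists>X p. prob_weights K X p \<and>
        (\<forall>U\<in>\<U>. \<exists>z\<in>U. \<bar>cover K X p z - (1/2) ^ DIM('a)\<bar> \<le> \<eta>)))"

lemma evenly_coveredD:
  fixes K :: "'a::euclidean_space set"
  assumes "evenly_covered K" "finite \<U>"
    and "\<And>U. U \<in> \<U> \<Longrightarrow> open U \<and> U \<noteq> {} \<and> U \<subseteq> (*\<^sub>R) 2 ` K" and "0 < \<eta>"
  obtains X p where "prob_weights K X p"
    "\<And>U. U \<in> \<U> \<Longrightarrow> \<exists>z\<in>U. \<bar>cover K X p z - (1/2) ^ DIM('a)\<bar> \<le> \<eta>"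
  using assms unfolding evenly_covered_def by metis

text \<open>
  By the variance formula an energy near the minimum makes the deviation of \<open>cover\<close> from
  \<open>(1/2)\<^sup>d\<close> small in square mean, so on no test set can it exceed \<open>\<eta>\<close> everywhere.
\<close>

lemma evenly_covered_if_min_energy:
  fixes K :: "'a::euclidean_space set"
  assumes K: "compact K" "convex K" "K \<noteq> {}"
    and m: "min_energy K = (1/2) ^ DIM('a) * measure lebesgue K"
  shows "evenly_covered K"
  unfolding evenly_covered_def
proof (intro allI impI)
  fix \<U> :: "'a set set" and \<eta> :: real
  assume fin: "finite \<U>" and U: "\<forall>U\<in>\<U>. open U \<and> U \<noteq> {} \<and> U \<subseteq> (*\<^sub>R) 2 ` K" and \<eta>: "\<eta> > 0"
  let ?D = "(*\<^sub>R) 2 ` K" and ?c = "(1/2) ^ DIM('a) :: real"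
  have bD: "bounded ?D" using K(1) by (intro compact_imp_bounded compact_scaling)
  have Um: "U \<in> lmeasurable" if "U \<in> \<U>" for U
    using U that bD by (meson bounded_subset lmeasurable_open)
  have Upos: "0 < measure lebesgue U" if "U \<in> \<U>" for U
  proof -
    have "\<not> negligible U" using U that open_not_negligible by blast
    then show ?thesis using Um[OF that] negligible_iff_measure0 zero_less_measure_iff by blast
  qed
  \<comment> \<open>The \<open>1\<close> serves the empty list of tests.\<close>
  define e where "e = Min (insert 1 (measure lebesgue ` \<U>))"
  have e: "0 < e" "\<And>U. U \<in> \<U> \<Longrightarrow> e \<le> measure lebesgue U"
    using fin Upos by (auto simp: e_def)
  have "\<exists>X p. prob_weights K X p \<and> energy K X p < min_energy K + \<eta>\<^sup>2 * e"
  proof -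
    obtain x where "x \<in> K" using K(3) by blast
    then have "{energy K X p |X p. prob_weights K X p} \<noteq> {}"
      using prob_weights_single[of x K] by (metis (mono_tags, lifting) empty_iff mem_Collect_eq)
    from cInf_lessD[OF this, of "min_energy K + \<eta>\<^sup>2 * e"] show ?thesis
      using \<eta> e by (auto simp: min_energy_def)
  qed
  then obtain X p where p: "prob_weights K X p" "energy K X p < min_energy K + \<eta>\<^sup>2 * e" by blast
  let ?f = "\<lambda>z. (cover K X p z - ?c * indicator ?D z)\<^sup>2"
  have "\<exists>z\<in>U. \<bar>cover K X p z - ?c\<bar> \<le> \<eta>" if UU: "U \<in> \<U>" for U
  proof (rule ccontr)
    assume "\<not> ?thesis"
    then have far: "\<eta> < \<bar>cover K X p z - ?c\<bar>" if "z \<in> U" for z using that by force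
    have "\<eta>\<^sup>2 * indicator U z \<le> ?f z" for z
    proof (cases "z \<in> U")
      case True
      then have "z \<in> ?D" using U UU by blast
      moreover have "\<eta>\<^sup>2 \<le> (cover K X p z - ?c)\<^sup>2"
        using far[OF True] \<eta> by (metis abs_le_square_iff abs_of_pos less_imp_le)
      ultimately show ?thesis using True by simp
    qed auto
    then have "integral\<^sup>L lebesgue (\<lambda>z. \<eta>\<^sup>2 * indicator U z) \<le> integral\<^sup>L lebesgue ?f"
      using Um[OF UU] integral_cover_deviation(1)[OF K(1,2) p(1)]
      by (intro integral_mono integrable_mult_right integrable_indicator_lmeasurable) auto
    moreover have "integral\<^sup>L lebesgue (\<lambda>z. \<eta>\<^sup>2 * indicator U z) = \<eta>\<^sup>2 * measure lebesgue U"
      by simp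
    moreover have "integral\<^sup>L lebesgue ?f < \<eta>\<^sup>2 * e"
      using integral_cover_deviation(2)[OF K(1,2) p(1)] p(2) m by simp
    moreover have "\<eta>\<^sup>2 * e \<le> \<eta>\<^sup>2 * measure lebesgue U" using e(2)[OF UU] by (simp add: mult_left_mono)
    ultimately show False by linarith
  qed
  then show "\<exists>X p. prob_weights K X p \<and> (\<forall>U\<in>\<U>. \<exists>z\<in>U. \<bar>cover K X p z - ?c\<bar> \<le> \<eta>)"
    using p(1) by blast
qed

text \<open>
  Twice an extreme point \<open>v\<close> is a sum of two points of \<open>K\<close> only as \<open>v + v\<close>, so by compactness all
  decompositions of a point near \<open>2v\<close> have both summands near \<open>v\<close>. Hence \<open>cover\<close> near \<open>2v\<close> sees only
  the mass near \<open>v\<close>.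
\<close>

lemma double_extreme_point_peak:
  fixes K :: "'a::euclidean_space set"
  assumes K: "compact K" "convex K" "interior K \<noteq> {}" and v: "v extreme_point_of K" and r: "0 < r"
  obtains U where "open U" "U \<noteq> {}" "U \<subseteq> (*\<^sub>R) 2 ` K"
    "\<And>z x. z \<in> U \<Longrightarrow> x \<in> K \<Longrightarrow> z - x \<in> K \<Longrightarrow> x \<in> ball v r"
proof -
  let ?D = "(*\<^sub>R) 2 ` K"
  define S where "S = {x + y |x y. x \<in> K - ball v r \<and> y \<in> K}"
  have S: "closed S" unfolding S_def
    by (intro compact_imp_closed compact_sums compact_diff K) simp
  have vK: "v \<in> K" using v by (simp add: extreme_point_of_def)
  have "2 *\<^sub>R v \<notin> S"
  proof
    assume "2 *\<^sub>R v \<in> S"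
    then obtain x y where xy: "x \<in> K" "x \<notin> ball v r" "y \<in> K" "2 *\<^sub>R v = x + y" by (auto simp: S_def)
    have "v = midpoint x y" using xy(4) by (simp add: midpoint_def flip: xy(4))
    moreover have "x \<noteq> y" using xy r \<open>v = midpoint x y\<close> by auto
    ultimately have "v \<in> open_segment x y" by simp
    then show False using v xy by (auto simp: extreme_point_of_def)
  qed
  moreover have "2 *\<^sub>R v \<in> closure (interior ?D)"
  proof -
    have "interior ?D = (*\<^sub>R) 2 ` interior K"
      by (rule interior_injective_linear_image) (auto simp: linear_scaleR inj_on_def)
    then have "interior ?D \<noteq> {}" using K(3) by simp
    then have "closure (interior ?D) = closure ?D"
      using K(2) by (intro convex_closure_interior convex_scaling)
    moreover have "2 *\<^sub>R v \<in> closure ?D"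
      by (rule subsetD[OF closure_subset]) (rule imageI[OF vK])
    ultimately show ?thesis by simp
  qed
  ultimately have "interior ?D \<inter> - S \<noteq> {}"
    using S closure_minimal[of "interior ?D" S] by auto
  moreover have "x \<in> ball v r" if "z \<in> interior ?D \<inter> - S" "x \<in> K" "z - x \<in> K" for z x
  proof (rule ccontr)
    assume "x \<notin> ball v r"
    then have "x + (z - x) \<in> S" unfolding S_def using that by blast
    then show False using that by simp
  qed
  ultimately show thesis
    using that[of "interior ?D \<inter> - S"] S interior_subset[of ?D] by (simp add: open_Int open_Compl le_infI1)
qed

text \<open>
  The two ways to read a value of \<open>cover\<close>: it is at most the mass of any set that contains all summands
  that can occur, and at least the mass of any set all of whose points do occur.
\<close>

lemma mass_peak_ge:
  assumes "prob_weights K X p" "z \<in> U" "\<bar>cover K X p z - c\<bar> \<le> \<eta>"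
    "\<And>z x. z \<in> U \<Longrightarrow> x \<in> K \<Longrightarrow> z - x \<in> K \<Longrightarrow> x \<in> B"
  shows "c - \<eta> \<le> mass X p B"
proof -
  have "cover K X p z \<le> mass X p B"
    unfolding cover_eq_mass[OF assms(1)]
    by (rule mass_mono[OF assms(1)]) (use assms in \<open>auto simp: prob_weights_def\<close>)
  then show ?thesis using assms(3) by linarith
qed

lemma mass_overlap_le:
  assumes "prob_weights K X p" "z \<in> U" "\<bar>cover K X p z - c\<bar> \<le> \<eta>"
    "\<And>z x. z \<in> U \<Longrightarrow> x \<in> B \<Longrightarrow> z - x \<in> K"
  shows "mass X p B \<le> c + \<eta>"
proof -
  have "mass X p B \<le> cover K X p z"
    unfolding cover_eq_mass[OF assms(1)]
    by (rule mass_mono[OF assms(1)]) (use assms in auto)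
  then show ?thesis using assms(3) by linarith
qed

text \<open>
  If the interiors of \<open>v + K\<close> and \<open>w + K\<close> meet, a whole open set of points \<open>z\<close> sees the masses near \<open>v\<close>
  and near \<open>w\<close> at once.
\<close>

lemma overlap_neighbourhood:
  fixes K :: "'a::euclidean_space set"
  assumes K: "convex K" and vw: "v \<in> K" and z: "z0 - v \<in> interior K" "z0 - w \<in> interior K"
  obtains U \<rho> where "open U" "U \<noteq> {}" "U \<subseteq> (*\<^sub>R) 2 ` K" "0 < \<rho>"
    "\<And>z x. z \<in> U \<Longrightarrow> x \<in> ball v \<rho> \<union> ball w \<rho> \<Longrightarrow> z - x \<in> K"
proof -
  obtain e1 where e1: "0 < e1" "ball (z0 - v) e1 \<subseteq> K" using z(1) by (meson mem_interior)
  obtain e2 where e2: "0 < e2" "ball (z0 - w) e2 \<subseteq> K" using z(2) by (meson mem_interior)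
  define \<rho> where "\<rho> = min e1 e2 / 2"
  have \<rho>: "0 < \<rho>" "2 * \<rho> \<le> e1" "2 * \<rho> \<le> e2" using e1 e2 by (auto simp: \<rho>_def)
  have near: "z - x \<in> ball (z0 - y) (2 * \<rho>)" if "z \<in> ball z0 \<rho>" "x \<in> ball y \<rho>" for z x y
  proof -
    have "dist (z0 - y) (z - x) \<le> dist z0 z + dist y x"
      unfolding dist_norm using norm_triangle_ineq4[of "z0 - z" "y - x"]
      by (simp add: algebra_simps)
    then show ?thesis using that by simp
  qed
  have in_K: "z - x \<in> K" if "z \<in> ball z0 \<rho>" "x \<in> ball v \<rho> \<union> ball w \<rho>" for z x
    using that near[of z x v] near[of z x w] e1(2) e2(2) \<rho> by auto
  have "z \<in> (*\<^sub>R) 2 ` K" if "z \<in> ball z0 \<rho>" for z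
  proof -
    have "z - v \<in> K" using in_K[of z v] that \<rho> by simp
    then have "z \<in> (+) v ` K" by (simp add: mem_translate_iff)
    then show ?thesis using translate_subset_double[OF K vw] by blast
  qed
  then show thesis using that[of "ball z0 \<rho>" \<rho>] \<rho> in_K by (metis centre_in_ball empty_iff open_ball subsetI)
qed

lemma separating_radius:
  fixes F :: "'a::metric_space set"
  assumes "finite F"
  obtains r where "0 < r" "disjoint_family_on (\<lambda>v. ball v r) F"
proof -
  define R where "R = Min (insert 1 ((\<lambda>(v,w). dist v w) ` {(v,w). v \<in> F \<and> w \<in> F \<and> v \<noteq> w}))"
  have fin: "finite {(v,w). v \<in> F \<and> w \<in> F \<and> v \<noteq> w}"
    by (rule finite_subset[of _ "F \<times> F"]) (use assms in auto)
  have "0 < R" unfolding R_def using fin by (subst Min_gr_iff) auto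
  moreover have "R \<le> dist v w" if "v \<in> F" "w \<in> F" "v \<noteq> w" for v w
    unfolding R_def using fin that by (intro Min_le) auto
  ultimately show thesis
    by (intro that[of "R/2"]) (auto simp: disjoint_family_on_def intro!: disjoint_ballI)
qed

text \<open>
  Every extreme point attracts mass at least about \<open>(1/2)\<^sup>d\<close>, and the total mass is \<open>1\<close>.
\<close>

lemma card_extreme_points_le:
  fixes K :: "'a::euclidean_space set"
  assumes K: "compact K" "convex K" "interior K \<noteq> {}" and ev: "evenly_covered K"
  shows "finite {v. v extreme_point_of K} \<and> card {v. v extreme_point_of K} \<le> 2 ^ DIM('a)"
proof (rule finite_if_finite_subsets_card_bdd)
  fix F assume F: "F \<subseteq> {v. v extreme_point_of K}" "finite F"
  let ?c = "(1/2) ^ DIM('a) :: real"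
  obtain r where r: "0 < r" "disjoint_family_on (\<lambda>v. ball v r) F"
    using separating_radius[OF F(2)] .
  have "\<forall>v\<in>F. \<exists>U. open U \<and> U \<noteq> {} \<and> U \<subseteq> (*\<^sub>R) 2 ` K \<and>
      (\<forall>z\<in>U. \<forall>x\<in>K. z - x \<in> K \<longrightarrow> x \<in> ball v r)"
  proof
    fix v assume "v \<in> F"
    then have "v extreme_point_of K" using F by blast
    then show "\<exists>U. open U \<and> U \<noteq> {} \<and> U \<subseteq> (*\<^sub>R) 2 ` K \<and>
      (\<forall>z\<in>U. \<forall>x\<in>K. z - x \<in> K \<longrightarrow> x \<in> ball v r)"
      by (rule double_extreme_point_peak[OF K _ r(1)]) metis
  qed
  then obtain U where U: "\<And>v. v \<in> F \<Longrightarrow> open (U v) \<and> U v \<noteq> {} \<and> U v \<subseteq> (*\<^sub>R) 2 ` K"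
    "\<And>v z x. v \<in> F \<Longrightarrow> z \<in> U v \<Longrightarrow> x \<in> K \<Longrightarrow> z - x \<in> K \<Longrightarrow> x \<in> ball v r"
    by metis
  have bound: "real (card F) * (?c - \<eta>) \<le> 1" if \<eta>: "0 < \<eta>" for \<eta>
  proof -
    have oU: "open W \<and> W \<noteq> {} \<and> W \<subseteq> (*\<^sub>R) 2 ` K" if "W \<in> U ` F" for W
    proof -
      obtain v where "v \<in> F" "W = U v" using \<open>W \<in> U ` F\<close> by blast
      then show ?thesis using U(1) by simp
    qed
    obtain X p where p: "prob_weights K X p"
      and near': "\<And>W. W \<in> U ` F \<Longrightarrow> \<exists>z\<in>W. \<bar>cover K X p z - ?c\<bar> \<le> \<eta>"
      by (rule evenly_coveredD[OF ev finite_imageI[OF F(2)] oU \<eta>], assumption) (rule that)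
    have near: "\<exists>z\<in>U v. \<bar>cover K X p z - ?c\<bar> \<le> \<eta>" if "v \<in> F" for v
      by (rule near') (rule imageI[OF that])
    have "?c - \<eta> \<le> mass X p (ball v r)" if "v \<in> F" for v
    proof -
      obtain z where z: "z \<in> U v" "\<bar>cover K X p z - ?c\<bar> \<le> \<eta>"
        using near[OF \<open>v \<in> F\<close>] by (rule bexE)
      show ?thesis by (rule mass_peak_ge[OF p z U(2)[OF \<open>v \<in> F\<close>]])
    qed
    then have "(\<Sum>v\<in>F. ?c - \<eta>) \<le> (\<Sum>v\<in>F. mass X p (ball v r))" by (rule sum_mono)
    also have "\<dots> \<le> 1" by (rule mass_UN_disjoint[OF p F(2) r(2)])
    finally show ?thesis by simp
  qed
  have "((\<lambda>\<eta>. real (card F) * (?c - \<eta>)) \<longlongrightarrow> real (card F) * (?c - 0)) (at_right 0)"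
    by (intro tendsto_intros)
  then have "real (card F) * (?c - 0) \<le> 1"
    by (rule tendsto_upperbound) (auto simp: eventually_at_filter bound)
  then have "real (card F) \<le> real (2 ^ DIM('a))" by (simp add: power_one_over field_simps)
  then show "card F \<le> 2 ^ DIM('a)" by (simp only: of_nat_le_iff)
qed

text \<open>
  Otherwise some \<open>z\<close> would see the masses near \<open>v\<close> and near \<open>w\<close> together, which is about twice the
  permitted value \<open>(1/2)\<^sup>d\<close>.
\<close>

lemma extreme_point_translates_disjoint:
  fixes K :: "'a::euclidean_space set"
  assumes K: "compact K" "convex K" "interior K \<noteq> {}" and ev: "evenly_covered K"
    and vw: "v extreme_point_of K" "w extreme_point_of K" "v \<noteq> w"
  shows "\<not> (z0 - v \<in> interior K \<and> z0 - w \<in> interior K)"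
proof
  assume z0: "z0 - v \<in> interior K \<and> z0 - w \<in> interior K"
  let ?c = "(1/2) ^ DIM('a) :: real"
  have "v \<in> K" using vw by (simp add: extreme_point_of_def)
  then obtain U \<rho> where U: "open U" "U \<noteq> {}" "U \<subseteq> (*\<^sub>R) 2 ` K" "0 < \<rho>"
    "\<And>z x. z \<in> U \<Longrightarrow> x \<in> ball v \<rho> \<union> ball w \<rho> \<Longrightarrow> z - x \<in> K"
    by (rule overlap_neighbourhood[OF K(2) _ conjunct1[OF z0] conjunct2[OF z0]]) (rule that)
  define r where "r = min \<rho> (dist v w / 2)"
  have r: "0 < r" "r \<le> \<rho>" "r + r \<le> dist v w" using U(4) vw(3) by (auto simp: r_def)
  obtain V where V: "open V" "V \<noteq> {}" "V \<subseteq> (*\<^sub>R) 2 ` K"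
    "\<And>z x. z \<in> V \<Longrightarrow> x \<in> K \<Longrightarrow> z - x \<in> K \<Longrightarrow> x \<in> ball v r"
    by (rule double_extreme_point_peak[OF K vw(1) r(1)]) (rule that)
  obtain W where W: "open W" "W \<noteq> {}" "W \<subseteq> (*\<^sub>R) 2 ` K"
    "\<And>z x. z \<in> W \<Longrightarrow> x \<in> K \<Longrightarrow> z - x \<in> K \<Longrightarrow> x \<in> ball w r"
    by (rule double_extreme_point_peak[OF K vw(2) r(1)]) (rule that)
  have oU: "open S \<and> S \<noteq> {} \<and> S \<subseteq> (*\<^sub>R) 2 ` K" if "S \<in> {U,V,W}" for S
    using that U(1-3) V(1-3) W(1-3) by (elim insertE) simp_all
  have fin3: "finite {U,V,W}" and c4: "0 < ?c/4" by simp_all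
  obtain X p where p: "prob_weights K X p"
    and near: "\<And>S. S \<in> {U,V,W} \<Longrightarrow> \<exists>z\<in>S. \<bar>cover K X p z - ?c\<bar> \<le> ?c/4"
    by (rule evenly_coveredD[OF ev fin3 oU c4], assumption) (rule that)
  obtain zu zv zw where
    z: "zu \<in> U" "\<bar>cover K X p zu - ?c\<bar> \<le> ?c/4" "zv \<in> V" "\<bar>cover K X p zv - ?c\<bar> \<le> ?c/4"
      "zw \<in> W" "\<bar>cover K X p zw - ?c\<bar> \<le> ?c/4"
    using near[of U] near[of V] near[of W] by auto
  have "?c - ?c/4 \<le> mass X p (ball v r)" using mass_peak_ge[OF p z(3,4) V(4)] .
  moreover have "?c - ?c/4 \<le> mass X p (ball w r)" using mass_peak_ge[OF p z(5,6) W(4)] .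
  moreover have "mass X p (ball v r) + mass X p (ball w r) = mass X p (ball v r \<union> ball w r)"
    by (rule mass_Un_disjoint[OF p, symmetric]) (rule disjoint_ballI[OF r(3)])
  moreover have "mass X p (ball v r \<union> ball w r) \<le> ?c + ?c/4"
    by (rule mass_overlap_le[OF p z(1,2)]) (use U(5) r(2) in force)
  moreover have "0 < ?c" by simp
  ultimately show False by linarith
qed

text \<open>
  Write \<open>w = s v + (1 - s) k\<close> with an extreme point \<open>v\<close>, some \<open>k \<in> K\<close> and \<open>s > 0\<close>, and let \<open>c0\<close> be
  interior. Then \<open>w + ((1 - s) v + s c0) = v + ((1 - s) k + s c0)\<close>, and both brackets are interior
  points of \<open>K\<close>.
\<close>

lemma overlap_with_extreme_point:
  fixes K :: "'a::euclidean_space set"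
  assumes K: "compact K" "convex K" "interior K \<noteq> {}" and fin: "finite {v. v extreme_point_of K}"
    and w: "w \<in> K" "\<not> w extreme_point_of K"
  obtains v z0 where "v extreme_point_of K" "z0 - v \<in> interior K" "z0 - w \<in> interior K"
proof -
  let ?V = "{v. v extreme_point_of K}"
  have "w \<in> convex hull ?V" using Krein_Milman_Minkowski[OF K(1,2)] w by simp
  then obtain u where u: "\<And>x. x \<in> ?V \<Longrightarrow> 0 \<le> u x" "sum u ?V = 1" "(\<Sum>x\<in>?V. u x *\<^sub>R x) = w"
    unfolding convex_hull_finite[OF fin] by blast
  have "\<exists>v\<in>?V. u v \<noteq> 0"
  proof (rule ccontr)
    assume "\<not> ?thesis"
    then have "sum u ?V = 0" by simp
    then show False using u(2) by simp
  qed
  then obtain v where v: "v \<in> ?V" "0 < u v" using u(1) by fastforce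
  have split: "sum u ?V = u v + sum u (?V - {v})"
    "(\<Sum>x\<in>?V. u x *\<^sub>R x) = u v *\<^sub>R v + (\<Sum>x\<in>?V - {v}. u x *\<^sub>R x)"
    using fin v(1) by (auto intro: sum.remove)
  have nn: "0 \<le> sum u (?V - {v})" using u(1) by (intro sum_nonneg) auto
  have vK: "v \<in> K" using v by (simp add: extreme_point_of_def)
  have "u v \<noteq> 1"
  proof
    assume "u v = 1"
    then have "sum u (?V - {v}) = 0" using split u(2) by simp
    then have "\<forall>x\<in>?V - {v}. u x = 0"
      using fin u(1) by (subst (asm) sum_nonneg_eq_0_iff) auto
    then have "(\<Sum>x\<in>?V - {v}. u x *\<^sub>R x) = 0" by (intro sum.neutral) auto
    then have "w = v" using split(2) u(3) \<open>u v = 1\<close> by simp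
    then show False using v w by simp
  qed
  then have lt: "u v < 1" using split u(2) nn by linarith
  define s where "s = u v"
  have l: "0 < s" "s < 1" using v lt by (auto simp: s_def)
  define k where "k = (\<Sum>x\<in>?V - {v}. (u x / (1 - s)) *\<^sub>R x)"
  have "k \<in> K" unfolding k_def
  proof (rule convex_sum[OF _ K(2)])
    show "(\<Sum>x\<in>?V - {v}. u x / (1 - s)) = 1"
      using split(1) u(2) l by (simp add: s_def field_simps flip: sum_divide_distrib)
  qed (use fin u(1) l in \<open>auto simp: extreme_point_of_def\<close>)
  have "(1 - s) *\<^sub>R k = (\<Sum>x\<in>?V - {v}. u x *\<^sub>R x)"
    using l by (simp add: k_def scaleR_sum_right)
  then have wk: "w = s *\<^sub>R v + (1 - s) *\<^sub>R k"
    using split(2) u(3) by (simp add: s_def)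
  obtain c0 where c0: "c0 \<in> interior K" using K(3) by blast
  define z0 where "z0 = w + (v - s *\<^sub>R (v - c0))"
  have "v - s *\<^sub>R (v - c0) \<in> interior K" "k - s *\<^sub>R (k - c0) \<in> interior K"
    using mem_interior_convex_shrink[OF K(2) c0] vK \<open>k \<in> K\<close> l by auto
  moreover have "z0 - w = v - s *\<^sub>R (v - c0)" by (simp add: z0_def)
  moreover have "z0 - v = k - s *\<^sub>R (k - c0)" by (simp add: z0_def wk algebra_simps)
  ultimately show thesis using that[of v z0] v by simp
qed

text \<open>
  Near a point that is not extreme there is almost no mass, because some \<open>z\<close> sees that mass in addition
  to the \<open>(1/2)\<^sup>d\<close> near an extreme point. Near an extreme point there is at most about
  \<open>(1/2)\<^sup>d\<close>. A finite cover of \<open>K\<close> by such neighbourhoods carries the whole mass \<open>1\<close>, so there are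
  enough extreme points.
\<close>

lemma card_extreme_points_ge:
  fixes K :: "'a::euclidean_space set"
  assumes K: "compact K" "convex K" "interior K \<noteq> {}" and ev: "evenly_covered K"
  shows "2 ^ DIM('a) \<le> card {v. v extreme_point_of K}"
proof -
  let ?V = "{v. v extreme_point_of K}" and ?c = "(1/2) ^ DIM('a) :: real"
  have fin: "finite ?V" using card_extreme_points_le[OF K ev] by blast
  define good where "good \<U> \<eta> X p \<longleftrightarrow> prob_weights K X p \<and>
      (\<forall>U\<in>\<U>. \<exists>z\<in>U. \<bar>cover K X p z - ?c\<bar> \<le> \<eta>)" for \<U> :: "'a set set" and \<eta> X p
  define peaked where "peaked w \<rho> \<U> \<longleftrightarrow> 0 < \<rho> \<and> finite \<U> \<and>
     (\<forall>U\<in>\<U>. open U \<and> U \<noteq> {} \<and> U \<subseteq> (*\<^sub>R) 2 ` K) \<and>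
     (\<forall>\<eta> X p. 0 < \<eta> \<longrightarrow> good \<U> \<eta> X p \<longrightarrow> mass X p (ball w \<rho>) \<le> (if w \<in> ?V then ?c else 0) + 2 * \<eta>)"
    for w :: 'a and \<rho> :: real and \<U> :: "'a set set"
  have "\<exists>\<rho> \<U>. peaked w \<rho> \<U>"
    if w: "w \<in> K" for w
  proof (cases "w \<in> ?V")
    case True
    obtain c0 where c0: "c0 \<in> interior K" using K(3) by blast
    then have i: "w + c0 - w \<in> interior K" by simp
    obtain U \<rho> where U: "open U" "U \<noteq> {}" "U \<subseteq> (*\<^sub>R) 2 ` K" "0 < \<rho>"
      "\<And>z x. z \<in> U \<Longrightarrow> x \<in> ball w \<rho> \<union> ball w \<rho> \<Longrightarrow> z - x \<in> K"
      by (rule overlap_neighbourhood[OF K(2) w i i]) (rule that)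
    have "mass X p (ball w \<rho>) \<le> ?c + 2 * \<eta>" if g: "0 < \<eta>" "good {U} \<eta> X p" for \<eta> X p
    proof -
      obtain z where z: "z \<in> U" "\<bar>cover K X p z - ?c\<bar> \<le> \<eta>" and p: "prob_weights K X p"
        using g by (auto simp: good_def)
      have "mass X p (ball w \<rho>) \<le> ?c + \<eta>" using mass_overlap_le[OF p z, of "ball w \<rho>"] U(5) by simp
      then show ?thesis using g by simp
    qed
    then show ?thesis using True U by (intro exI[of _ \<rho>] exI[of _ "{U}"]) (auto simp: peaked_def)
  next
    case False
    then obtain v z0 where v: "v extreme_point_of K" "z0 - v \<in> interior K" "z0 - w \<in> interior K"
      using overlap_with_extreme_point[OF K fin w] by auto
    have "v \<noteq> w" using v False by auto
    have "v \<in> K" using v by (simp add: extreme_point_of_def)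
    then obtain U \<rho> where U: "open U" "U \<noteq> {}" "U \<subseteq> (*\<^sub>R) 2 ` K" "0 < \<rho>"
      "\<And>z x. z \<in> U \<Longrightarrow> x \<in> ball v \<rho> \<union> ball w \<rho> \<Longrightarrow> z - x \<in> K"
      by (rule overlap_neighbourhood[OF K(2) _ v(2,3)]) (rule that)
    define r where "r = min \<rho> (dist v w / 2)"
    have r: "0 < r" "r \<le> \<rho>" "r + r \<le> dist v w" using U(4) \<open>v \<noteq> w\<close> by (auto simp: r_def)
    obtain V where V: "open V" "V \<noteq> {}" "V \<subseteq> (*\<^sub>R) 2 ` K"
      "\<And>z x. z \<in> V \<Longrightarrow> x \<in> K \<Longrightarrow> z - x \<in> K \<Longrightarrow> x \<in> ball v r"
      by (rule double_extreme_point_peak[OF K v(1) r(1)]) (rule that)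
    have "mass X p (ball w r) \<le> 2 * \<eta>" if g: "0 < \<eta>" "good {U,V} \<eta> X p" for \<eta> X p
    proof -
      obtain zu zv where z: "zu \<in> U" "\<bar>cover K X p zu - ?c\<bar> \<le> \<eta>" "zv \<in> V" "\<bar>cover K X p zv - ?c\<bar> \<le> \<eta>"
        and p: "prob_weights K X p"
        using g by (auto simp: good_def)
      have "?c - \<eta> \<le> mass X p (ball v r)" using mass_peak_ge[OF p z(3,4) V(4)] .
      moreover have "mass X p (ball v r) + mass X p (ball w r) = mass X p (ball v r \<union> ball w r)"
        by (rule mass_Un_disjoint[OF p, symmetric]) (rule disjoint_ballI[OF r(3)])
      moreover have "mass X p (ball v r \<union> ball w r) \<le> ?c + \<eta>"
        by (rule mass_overlap_le[OF p z(1,2)]) (use U(5) r(2) in force)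
      ultimately show ?thesis by linarith
    qed
    then show ?thesis using False U V r(1) by (intro exI[of _ r] exI[of _ "{U,V}"]) (auto simp: peaked_def)
  qed
  then obtain \<rho> \<U> where peaked: "\<And>w. w \<in> K \<Longrightarrow> peaked w (\<rho> w) (\<U> w)"
    by metis
  have \<rho>: "0 < \<rho> w" and \<U>: "finite (\<U> w)"
      "\<And>U. U \<in> \<U> w \<Longrightarrow> open U \<and> U \<noteq> {} \<and> U \<subseteq> (*\<^sub>R) 2 ` K"
    and bnd: "\<And>\<eta> X p. 0 < \<eta> \<Longrightarrow> good (\<U> w) \<eta> X p \<Longrightarrow>
        mass X p (ball w (\<rho> w)) \<le> (if w \<in> ?V then ?c else 0) + 2 * \<eta>"
    if "w \<in> K" for w
    using peaked[OF that] unfolding peaked_def by simp_all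
  have op: "open (ball w (\<rho> w))" for w by simp
  have cov: "K \<subseteq> (\<Union>w\<in>K. ball w (\<rho> w))"
  proof
    fix w assume w: "w \<in> K"
    then have "w \<in> ball w (\<rho> w)" using \<rho> by simp
    then show "w \<in> (\<Union>w\<in>K. ball w (\<rho> w))" using w by (rule UN_I[rotated])
  qed
  obtain W where W: "W \<subseteq> K" "finite W" "K \<subseteq> (\<Union>w\<in>W. ball w (\<rho> w))"
    by (rule compactE_image[OF K(1) op cov]) (rule that)
  have bound: "1 \<le> real (card ?V) * ?c + real (card W) * (2 * \<eta>)" if \<eta>: "0 < \<eta>" for \<eta>
  proof -
    have oU: "open U \<and> U \<noteq> {} \<and> U \<subseteq> (*\<^sub>R) 2 ` K" if "U \<in> (\<Union>w\<in>W. \<U> w)" for U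
    proof -
      obtain w where "w \<in> W" "U \<in> \<U> w" using \<open>U \<in> (\<Union>w\<in>W. \<U> w)\<close> by (rule UN_E)
      then show ?thesis using \<U>(2)[of w U] W(1) by (simp add: subset_iff)
    qed
    have fU: "finite (\<Union>w\<in>W. \<U> w)" by (intro finite_UN_I W(2) \<U>(1) subsetD[OF W(1)])
    obtain X p where p: "prob_weights K X p"
      and near: "\<And>U. U \<in> (\<Union>w\<in>W. \<U> w) \<Longrightarrow> \<exists>z\<in>U. \<bar>cover K X p z - ?c\<bar> \<le> \<eta>"
      by (rule evenly_coveredD[OF ev fU oU \<eta>], assumption) (rule that)
    have "1 = mass X p (\<Union>w\<in>W. ball w (\<rho> w))" using mass_body[OF p W(3)] by simp
    also have "\<dots> \<le> (\<Sum>w\<in>W. mass X p (ball w (\<rho> w)))" by (rule mass_UN_le[OF p W(2)])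
    also have "\<dots> \<le> (\<Sum>w\<in>W. (if w \<in> ?V then ?c else 0) + 2 * \<eta>)"
    proof (rule sum_mono)
      fix w assume w: "w \<in> W"
      then have "good (\<U> w) \<eta> X p" unfolding good_def by (intro conjI p ballI near UN_I)
      then show "mass X p (ball w (\<rho> w)) \<le> (if w \<in> ?V then ?c else 0) + 2 * \<eta>"
        by (rule bnd[OF subsetD[OF W(1) w] \<eta>])
    qed
    also have "\<dots> = real (card (W \<inter> ?V)) * ?c + real (card W) * (2 * \<eta>)"
      by (simp add: sum.distrib sum.If_cases[OF W(2)])
    also have "\<dots> \<le> real (card ?V) * ?c + real (card W) * (2 * \<eta>)"
      using card_mono[OF fin, of "W \<inter> ?V"] by (simp add: mult_right_mono)
    finally show ?thesis .
  qed
  have "((\<lambda>\<eta>. real (card ?V) * ?c + real (card W) * (2 * \<eta>)) \<longlongrightarrow>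
      real (card ?V) * ?c + real (card W) * (2 * 0)) (at_right 0)"
    by (intro tendsto_intros)
  then have "1 \<le> real (card ?V) * ?c + real (card W) * (2 * 0)"
    by (rule tendsto_lowerbound) (auto simp: eventually_at_filter bound)
  then have "real (2 ^ DIM('a)) \<le> real (card ?V)" by (simp add: power_one_over field_simps)
  then show ?thesis by (simp only: of_nat_le_iff)
qed

text \<open>
  The \<open>2\<^sup>d\<close> translates \<open>v + K\<close> lie in \<open>2K\<close>, overlap only in null sets, and have the volume of \<open>2K\<close>
  in total.
\<close>

lemma vertex_translates_tile:
  fixes K :: "'a::euclidean_space set"
  assumes K: "compact K" "convex K" "interior K \<noteq> {}" and ev: "evenly_covered K"
    and H: "closed H"
  defines "V \<equiv> {v. v extreme_point_of K}"
  shows "measure lebesgue ((*\<^sub>R) 2 ` K \<inter> H) = (\<Sum>v\<in>V. measure lebesgue ((+) v ` K \<inter> H))"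
proof -
  let ?D = "(*\<^sub>R) 2 ` K" and ?T = "\<lambda>v. (+) v ` K"
  have fin: "finite V" and card: "card V = 2 ^ DIM('a)"
    using card_extreme_points_le[OF K ev] card_extreme_points_ge[OF K ev] by (auto simp: V_def)
  have Tm: "?T v \<in> lmeasurable" for v
    using K(1) by (intro measurable_translation lmeasurable_compact)
  have TH: "?T v \<inter> H \<in> lmeasurable" for v
    using Tm H by (simp add: fmeasurable_Int_fmeasurable)
  have Dm: "?D \<in> lmeasurable" by (intro lmeasurable_compact compact_scaling K)
  have neg: "negligible (?T v \<inter> ?T w)" if "v \<in> V" "w \<in> V" "v \<noteq> w" for v w
  proof -
    have "convex (?T v \<inter> ?T w)" using K(2) by (intro convex_Int convex_translation)
    moreover have "interior (?T v \<inter> ?T w) = {}"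
    proof (rule ccontr)
      assume "interior (?T v \<inter> ?T w) \<noteq> {}"
      then obtain z where "z \<in> (+) v ` interior K" "z \<in> (+) w ` interior K"
        by (auto simp: interior_Int interior_translation)
      then have "z - v \<in> interior K \<and> z - w \<in> interior K"
        by (simp add: mem_translate_iff)
      then show False
        using extreme_point_translates_disjoint[OF K ev, of v w z] that by (auto simp: V_def)
    qed
    ultimately show ?thesis by (simp add: negligible_convex_interior)
  qed
  let ?U = "\<Union>(?T ` V)"
  have Um: "?U \<in> lmeasurable" using fin Tm by (intro fmeasurable.finite_Union) auto
  have sub: "?U \<subseteq> ?D"
    using translate_subset_double[OF K(2)] by (auto simp: V_def extreme_point_of_def)
  have "measure lebesgue ?U = (\<Sum>v\<in>V. measure lebesgue (?T v))"
    using fin Tm neg by (intro measure_negligible_finite_Union_image) (auto simp: pairwise_def)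
  also have "\<dots> = measure lebesgue ?D"
    by (simp add: measure_translation card measure_scaleR_image)
  finally have "measure lebesgue (?D - ?U) = 0"
    using Um Dm sub by (simp add: measurable_measure_Diff fmeasurableD)
  then have rest: "negligible (?D - ?U)"
    using Um Dm by (simp add: negligible_iff_measure fmeasurable.Diff)
  have "measure lebesgue (?D \<inter> H) = measure lebesgue (?U \<inter> H)"
  proof (rule measure_negligible_symdiff)
    show "?U \<inter> H \<in> lmeasurable" using Um H by (simp add: fmeasurable_Int_fmeasurable)
    show "negligible (?U \<inter> H - ?D \<inter> H \<union> (?D \<inter> H - ?U \<inter> H))"
      by (rule negligible_subset[OF rest]) (use sub in auto)
  qed
  also have "?U \<inter> H = \<Union>((\<lambda>v. ?T v \<inter> H) ` V)" by auto
  also have "measure lebesgue \<dots> = (\<Sum>v\<in>V. measure lebesgue (?T v \<inter> H))"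
  proof (intro measure_negligible_finite_Union_image fin TH pairwiseI)
    fix v w assume "v \<in> V" "w \<in> V" "v \<noteq> w"
    then show "negligible (?T v \<inter> H \<inter> (?T w \<inter> H))"
      by (rule negligible_subset[OF neg]) auto
  qed
  finally show ?thesis .
qed

section \<open>Two levels over every facet\<close>

text \<open>
  Here \<open>G s\<close> stands for the volume of the part of \<open>K\<close> at level at most \<open>s\<close> over a facet, \<open>c v\<close> for the
  level of the vertex \<open>v\<close> and \<open>T\<close> for the largest level. The tiling gives the equation \<open>tile\<close>, and
  contraction towards a point at level \<open>T\<close> gives \<open>hom\<close>: a slab that is moved upwards loses volume at most
  by the \<open>d\<close>-th power of the contraction factor.

  Suppose that \<open>m\<close>, the least positive level of a vertex, is below \<open>T\<close>. Under level \<open>m\<close> the equation reads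
  \<open>G (s/2) = \<theta> G s\<close> with \<open>\<theta>\<close> the proportion of vertices at level \<open>0\<close>. The linear lower bound on \<open>G\<close> and
  \<open>hom\<close> at small scales force \<open>\<theta> = 1/2\<close>; then \<open>hom\<close>, applied at smaller and smaller scales where its
  factor tends to \<open>1\<close>, makes the increments of \<open>G\<close> nondecreasing on \<open>[0, m]\<close>. Just above \<open>m\<close> the vertices
  at level \<open>m\<close> enter the equation and the slab volume per unit of height drops by a fixed proportion, which
  \<open>hom\<close> forbids.
\<close>

lemma self_similar_slices_two_levels:
  fixes G :: "real \<Rightarrow> real" and c :: "'v \<Rightarrow> real"
  assumes V: "finite V" "card V = 2 ^ d" and c: "\<And>v. v \<in> V \<Longrightarrow> 0 \<le> c v" "\<And>v. v \<in> V \<Longrightarrow> c v \<le> T"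
    and G0: "\<And>s. s \<le> 0 \<Longrightarrow> G s = 0" and Gnn: "\<And>s. 0 \<le> G s"
    and \<kappa>: "0 < \<kappa>" and Gpos: "\<And>s. 0 \<le> s \<Longrightarrow> s \<le> T \<Longrightarrow> \<kappa> * s \<le> G s"
    and tile: "\<And>s. 2 ^ d * G (s / 2) = (\<Sum>v\<in>V. G (s - c v))"
    and hom: "\<And>a a' h. 0 \<le> a \<Longrightarrow> a \<le> a' \<Longrightarrow> a' < T \<Longrightarrow> 0 \<le> h \<Longrightarrow>
       ((T - a') / (T - a)) ^ d * (G (a + h) - G a) \<le> G (a' + h) - G a'"
    and v: "v \<in> V"
  shows "c v = 0 \<or> c v = T"
proof (rule ccontr)
  assume "\<not> ?thesis"
  then have v0: "0 < c v" "c v < T" using c[OF v] by linarith+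
  define P where "P = c ` V \<inter> {0<..}"
  have P: "finite P" "c v \<in> P" using V v v0 by (auto simp: P_def)
  define m where "m = Min P"
  have "m \<in> P" unfolding m_def using P by (intro Min_in) auto
  then obtain v1 where v1: "v1 \<in> V" "c v1 = m" and m0: "0 < m" by (auto simp: P_def)
  have "m \<le> c v" unfolding m_def using P by (intro Min_le) auto
  then have mT: "m < T" using v0 by linarith
  have m_le: "m \<le> c u" if "u \<in> V" "c u \<noteq> 0" for u
    unfolding m_def using P that c(1)[OF that(1)] by (intro Min_le) (auto simp: P_def)
  define Z where "Z = {u\<in>V. c u = 0}"
  define \<theta> where "\<theta> = real (card Z) / 2 ^ d"
  have Gm: "0 < G s" if "0 < s" "s \<le> m" for s
    using Gpos[of s] that mT \<kappa> by (smt (verit) mult_pos_pos)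
  have half: "G (s / 2) = \<theta> * G s" if s: "s \<le> m" for s
  proof -
    have "(\<Sum>u\<in>V. G (s - c u)) = (\<Sum>u\<in>Z. G (s - c u))"
    proof (rule sum.mono_neutral_right)
      show "\<forall>u\<in>V - Z. G (s - c u) = 0"
      proof
        fix u assume "u \<in> V - Z"
        then have "m \<le> c u" using m_le by (auto simp: Z_def)
        then show "G (s - c u) = 0" using s by (intro G0) linarith
      qed
    qed (use V in \<open>auto simp: Z_def\<close>)
    also have "\<dots> = real (card Z) * G s" by (simp add: Z_def)
    finally have "2 ^ d * G (s / 2) = real (card Z) * G s" using tile by simp
    then show ?thesis by (simp add: \<theta>_def field_simps)
  qed
  have pw: "G (s / 2 ^ k) = \<theta> ^ k * G s" if "0 \<le> s" "s \<le> m" for s k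
  proof (induction k)
    case (Suc k)
    have "s / 2 ^ k \<le> s / 1" using that(1) by (intro divide_left_mono) auto
    then have "G (s / 2 ^ k / 2) = \<theta> * G (s / 2 ^ k)" using that by (intro half) linarith
    then show ?case using Suc by (simp add: mult_ac)
  qed simp
  have \<theta>_nn: "0 \<le> \<theta>" by (simp add: \<theta>_def)
  \<comment> \<open>Otherwise \<open>G\<close> would decay faster than linearly at \<open>0\<close>.\<close>
  have \<theta>_ge: "1 \<le> 2 * \<theta>"
  proof (rule ccontr)
    assume "\<not> ?thesis"
    then obtain k where "(2 * \<theta>) ^ k < \<kappa> * m / G m"
      using real_arch_pow_inv[of "\<kappa> * m / G m" "2 * \<theta>"] \<kappa> m0 Gm[of m] by auto
    then have "(2 * \<theta>) ^ k * G m < \<kappa> * m" using Gm[of m] m0 by (simp add: pos_less_divide_eq)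
    then have "2 ^ k * (\<theta> ^ k * G m) < \<kappa> * m" by (simp add: power_mult_distrib mult.assoc)
    then have "2 ^ k * G (m / 2 ^ k) < \<kappa> * m" using pw[of m k] m0 by simp
    moreover have "\<kappa> * (m / 2 ^ k) \<le> G (m / 2 ^ k)"
    proof (rule Gpos)
      have "m / 2 ^ k \<le> m / 1" using m0 by (intro divide_left_mono) auto
      then show "m / 2 ^ k \<le> T" using mT by linarith
    qed (use m0 in simp)
    ultimately show False by (simp add: field_simps)
  qed
  have \<theta>_le: "\<theta> * (1 + (1 - x / (2 * T)) ^ d) \<le> 1" if x: "0 < x" "x \<le> m" for x
  proof -
    have "((T - x/2) / (T - 0)) ^ d * (G (0 + x/2) - G 0) \<le> G (x/2 + x/2) - G (x/2)"
      by (rule hom) (use x m0 mT in auto)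
    then have "(1 - x / (2 * T)) ^ d * G (x/2) \<le> G x - G (x/2)"
      using m0 mT by (simp add: G0 diff_divide_distrib mult.commute)
    then have "(\<theta> * (1 + (1 - x / (2 * T)) ^ d)) * G x \<le> 1 * G x"
      unfolding half[OF x(2)] by (simp add: algebra_simps)
    then show ?thesis using Gm[OF x] by (rule mult_right_le_imp_le)
  qed
  have \<theta>: "\<theta> = 1/2"
  proof -
    have "((\<lambda>x. \<theta> * (1 + (1 - x / (2 * T)) ^ d)) \<longlongrightarrow> \<theta> * (1 + (1 - 0 / (2 * T)) ^ d)) (at_right 0)"
      by (intro tendsto_intros) (use m0 mT in auto)
    moreover have "\<forall>\<^sub>F x in at_right 0. \<theta> * (1 + (1 - x / (2 * T)) ^ d) \<le> 1"
      using eventually_at_right_real[OF m0] by eventually_elim (auto intro: \<theta>_le)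
    ultimately have "\<theta> * (1 + (1 - 0 / (2 * T)) ^ d) \<le> 1"
      by (rule tendsto_upperbound) simp
    then show ?thesis using \<theta>_ge by simp
  qed
  have scale: "G (s / 2 ^ k) = G s / 2 ^ k" if "0 \<le> s" "s \<le> m" for s k
    using pw[OF that, of k] by (simp add: \<theta> power_divide)
  \<comment> \<open>Scaling down by powers of two preserves the ratio of increments and sends the factor in \<open>hom\<close> to \<open>1\<close>.\<close>
  have incr: "G (x + h) - G x \<le> G (x' + h) - G x'" if x: "0 \<le> x" "x \<le> x'" "0 \<le> h" "x' + h \<le> m" for x x' h
  proof -
    have le: "((T - x' / 2 ^ k) / (T - x / 2 ^ k)) ^ d * (G (x + h) - G x) \<le> G (x' + h) - G x'" for k :: nat
    proof -
      have "x' / 2 ^ k \<le> x' / 1" using x by (intro divide_left_mono) auto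
      then have "((T - x' / 2 ^ k) / (T - x / 2 ^ k)) ^ d * (G (x / 2 ^ k + h / 2 ^ k) - G (x / 2 ^ k))
         \<le> G (x' / 2 ^ k + h / 2 ^ k) - G (x' / 2 ^ k)"
        using x mT by (intro hom) (auto simp: divide_right_mono)
      then show ?thesis
        using x by (simp add: scale divide_le_cancel flip: add_divide_distrib diff_divide_distrib)
    qed
    have "(\<lambda>k. ((T - x' / 2 ^ k) / (T - x / 2 ^ k)) ^ d * (G (x + h) - G x))
        \<longlonglongrightarrow> ((T - 0) / (T - 0)) ^ d * (G (x + h) - G x)"
      by (intro tendsto_intros LIMSEQ_divide_realpow_zero) (use m0 mT in auto)
    then have "((T - 0) / (T - 0)) ^ d * (G (x + h) - G x) \<le> G (x' + h) - G x'"
      by (rule LIMSEQ_le_const2) (use le in blast)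
    then show ?thesis using m0 mT by simp
  qed
  \<comment> \<open>The step is a dyadic fraction of \<open>m\<close> so that \<open>G h\<close> is known exactly.\<close>
  have main: "1 / 2 ^ d \<le> 1 - ((T - m) / (T - m + m / 2 ^ Suc k)) ^ d" for k
  proof -
    define h where "h = m / 2 ^ Suc k"
    define l where "l = ((T - m) / (T - m + h)) ^ d"
    define D where "D = G (m/2 + h/2) - G (m/2)"
    have "m / 2 ^ Suc k \<le> m / 2" using m0 by (intro divide_left_mono) auto
    then have h: "0 < h" "h \<le> m / 2" using m0 by (auto simp: h_def)
    have Gh: "G h = G m / 2 ^ Suc k" unfolding h_def using m0 by (intro scale) auto
    \<comment> \<open>Besides the vertices at level \<open>0\<close>, the vertex \<open>v1\<close> at level \<open>m\<close> now contributes \<open>G h\<close>.\<close>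
    have a: "G (m + h) - G m \<le> 2 * D - 2 * G h / 2 ^ d"
    proof -
      have v1Z: "v1 \<notin> Z" using v1 m0 by (simp add: Z_def)
      have "real (card Z) * G (m + h) + G h = (\<Sum>u\<in>insert v1 Z. G (m + h - c u))"
        using v1Z V v1 by (simp add: Z_def)
      also have "\<dots> \<le> (\<Sum>u\<in>V. G (m + h - c u))"
        using V v1 Gnn by (intro sum_mono2) (auto simp: Z_def)
      also have "\<dots> = 2 ^ d * G ((m + h) / 2)" using tile by simp
      finally have "real (card Z) * G (m + h) + G h \<le> 2 ^ d * G (m/2 + h/2)"
        by (simp add: add_divide_distrib)
      moreover have "real (card Z) = 2 ^ d / 2" using \<theta> by (simp add: \<theta>_def field_simps)
      moreover have "G (m/2) = G m / 2" using scale[of m 1] m0 by simp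
      ultimately show ?thesis by (simp add: D_def field_simps)
    qed
    have b: "l * (G m - G (m - h)) \<le> G (m + h) - G m"
      using hom[of "m - h" m h] h mT m0 by (simp add: l_def algebra_simps)
    have "D \<le> G (m - h/2 + h/2) - G (m - h/2)" "D \<le> G (m - h + h/2) - G (m - h)"
      unfolding D_def using h m0 by (intro incr; simp)+
    then have "2 * D \<le> G m - G (m - h)" by simp
    moreover have l0: "0 \<le> l" unfolding l_def using mT h by simp
    ultimately have "l * (2 * D) \<le> 2 * D - 2 * G h / 2 ^ d"
      using a b mult_left_mono[of "2 * D" "G m - G (m - h)" l] by linarith
    then have "2 * (G h / 2 ^ d) \<le> 2 * (D * (1 - l))" by (simp add: algebra_simps)
    then have e: "G h / 2 ^ d \<le> D * (1 - l)" by simp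
    \<comment> \<open>\<open>D\<close> is the smallest of the increments of length \<open>h/2\<close> that fill the upper half of \<open>[0, m]\<close>.\<close>
    have "2 ^ Suc k * D \<le> G m"
    proof -
      let ?g = "\<lambda>j. G (m/2 + real j * (h/2))"
      have "D \<le> ?g (Suc j) - ?g j" if j: "j < 2 ^ Suc k" for j
      proof -
        have "real (Suc j) \<le> real (2 ^ Suc k)" using j by (simp only: of_nat_le_iff Suc_le_eq)
        then have "real (Suc j) \<le> 2 ^ Suc k" by (simp only: of_nat_power of_nat_numeral)
        then have "real (Suc j) * (h/2) \<le> 2 ^ Suc k * (h/2)" using h by (intro mult_right_mono) auto
        also have "\<dots> = m / 2" by (simp add: h_def)
        finally have "D \<le> G (m/2 + real j * (h/2) + h/2) - G (m/2 + real j * (h/2))"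
          unfolding D_def using h by (intro incr) (auto simp: algebra_simps)
        moreover have "m/2 + real (Suc j) * (h/2) = m/2 + real j * (h/2) + h/2"
          by (simp add: distrib_right)
        ultimately show ?thesis by (simp only:)
      qed
      then have "(\<Sum>j<(2::nat) ^ Suc k. D) \<le> (\<Sum>j<(2::nat) ^ Suc k. ?g (Suc j) - ?g j)" by (intro sum_mono) simp
      also have "\<dots> = ?g (2 ^ Suc k) - ?g 0" by (rule sum_lessThan_telescope)
      also have "?g (2 ^ Suc k) = G m" by (simp add: h_def)
      finally show ?thesis using Gnn[of "m/2"] by simp
    qed
    then have D_le: "D \<le> G h" unfolding Gh by (simp add: field_simps)
    have "l \<le> 1" unfolding l_def using mT h by (intro power_le_one) auto
    then have "G h * (1 / 2 ^ d) \<le> G h * (1 - l)"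
      using e mult_right_mono[OF D_le, of "1 - l"] by simp
    moreover have "0 < G h" using h m0 by (intro Gm) auto
    ultimately show ?thesis unfolding l_def h_def by (simp only: mult_le_cancel_left_pos)
  qed
  have "(\<lambda>k. m / 2 ^ Suc k) \<longlonglongrightarrow> 0"
    by (rule LIMSEQ_Suc) (rule LIMSEQ_divide_realpow_zero, simp)
  then have "(\<lambda>k. 1 - ((T - m) / (T - m + m / 2 ^ Suc k)) ^ d) \<longlonglongrightarrow> 1 - ((T - m) / (T - m + 0)) ^ d"
    by (intro tendsto_intros) (use mT in auto)
  then have "1 / 2 ^ d \<le> 1 - ((T - m) / (T - m + 0)) ^ d"
    by (rule LIMSEQ_le_const) (use main in blast)
  moreover have "((T - m) / (T - m + 0)) ^ d = 1" using mT by simp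
  moreover have "0 < 1 / (2::real) ^ d" by (rule divide_pos_pos) simp_all
  ultimately show False by linarith
qed

text \<open>
  The volume function of a facet satisfies the hypotheses of the previous lemma. That the facet has full
  dimension \<open>d - 1\<close> enters only through the linear lower bound: the cone \<open>C\<close> over it with apex at the
  highest point \<open>q\<close> has positive volume, and the part of \<open>C\<close> above level \<open>s\<close> is contained in a copy of
  \<open>C\<close> contracted towards \<open>q\<close>.
\<close>

lemma facet_two_levels:
  fixes K :: "'a::euclidean_space set"
  assumes K: "compact K" "convex K" "interior K \<noteq> {}" and ev: "evenly_covered K"
    and F: "F facet_of K" "K \<subseteq> {x. a \<bullet> x \<le> b}" "F = K \<inter> {x. a \<bullet> x = b}" and a: "a \<noteq> 0"
  obtains T where "0 < T" "\<And>v. v extreme_point_of K \<Longrightarrow> a \<bullet> v = b \<or> a \<bullet> v = b - T"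
proof -
  let ?V = "{v. v extreme_point_of K}" and ?d = "DIM('a)"
  have fin: "finite ?V" and card: "card ?V = 2 ^ ?d"
    using card_extreme_points_le[OF K ev] card_extreme_points_ge[OF K ev] by auto
  have Km: "K \<in> lmeasurable" using K(1) by (rule lmeasurable_compact)
  define lev where "lev x = b - a \<bullet> x" for x
  have lev0: "0 \<le> lev x" if "x \<in> K" for x using that F(2) by (auto simp: lev_def)
  have "K \<noteq> {}" using K(3) by auto
  moreover have "continuous_on K lev" unfolding lev_def by (intro continuous_intros)
  ultimately obtain q where q: "q \<in> K" "\<And>x. x \<in> K \<Longrightarrow> lev x \<le> lev q"
    using continuous_attains_sup[OF K(1), of lev] by blast
  define T where "T = lev q"
  obtain c0 where c0: "c0 \<in> interior K" using K(3) by blast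
  have "0 < lev c0"
    using interior_mono[OF F(2)] c0 interior_halfspace_le[OF a, of b] by (auto simp: lev_def)
  then have T: "0 < T" using q(2)[of c0] c0 interior_subset by (fastforce simp: T_def)
  define G where "G s = measure lebesgue {x\<in>K. lev x \<le> s}" for s
  have closed_lev: "closed {x. lev x \<le> s}" for s
    unfolding lev_def by (intro closed_Collect_le continuous_intros)
  have compact_lev: "compact {x\<in>K. lev x \<le> s}" for s
    using compact_Int_closed[OF K(1) closed_lev[of s]] by (simp add: Collect_conj_eq)
  have Sm: "{x\<in>K. lev x \<le> s} \<in> lmeasurable" for s
    by (rule lmeasurable_compact[OF compact_lev])
  have diff: "G t - G s = measure lebesgue {x\<in>K. s < lev x \<and> lev x \<le> t}" if "s \<le> t" for s t
  proof -
    have "{x\<in>K. s < lev x \<and> lev x \<le> t} = {x\<in>K. lev x \<le> t} - {x\<in>K. lev x \<le> s}" by auto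
    moreover have "measure lebesgue ({x\<in>K. lev x \<le> t} - {x\<in>K. lev x \<le> s}) = G t - G s"
      unfolding G_def by (rule measurable_measure_Diff[OF Sm fmeasurableD[OF Sm]]) (use that in auto)
    ultimately show ?thesis by simp
  qed
  have slab_m: "{x\<in>K. s < lev x \<and> lev x \<le> t} \<in> lmeasurable" for s t
  proof -
    have "{x\<in>K. s < lev x \<and> lev x \<le> t} = {x\<in>K. lev x \<le> t} - {x\<in>K. lev x \<le> s}" by auto
    then show ?thesis by (simp add: fmeasurable.Diff Sm)
  qed
  have levq: "lev (q + r *\<^sub>R (x - q)) = T - r * (T - lev x)" for r x
    by (simp add: lev_def T_def inner_add_right inner_diff_right algebra_simps)
  have G0: "G s = 0" if "s \<le> 0" for s
  proof -
    have "{x\<in>K. lev x \<le> s} \<subseteq> {x. a \<bullet> x = b}" using lev0 that by (force simp: lev_def)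
    then have "negligible {x\<in>K. lev x \<le> s}" using a negligible_hyperplane negligible_subset by blast
    then show ?thesis unfolding G_def by (rule negligible_imp_measure0)
  qed
  have Gpos: "\<exists>\<kappa>>0. \<forall>s. 0 \<le> s \<longrightarrow> s \<le> T \<longrightarrow> \<kappa> * s \<le> G s"
  proof -
    define C where "C = convex hull (insert q F)"
    have FK: "F face_of K" and Fne: "F \<noteq> {}" using F(1) by (simp_all add: facet_of_def)
    then have cF: "convex F" and FK: "F \<subseteq> K"
      by (simp_all add: face_of_imp_convex face_of_imp_subset)
    have CK: "C \<subseteq> K" unfolding C_def using FK q(1) K(2) by (intro hull_minimal) auto
    have compF: "compact F"
      using F(1) K face_of_imp_compact by (auto simp: facet_of_def)
    have compC: "compact C" unfolding C_def
      using compF by (intro compact_convex_hull compact_insert)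
    have Cm: "C \<in> lmeasurable" using compC by (rule lmeasurable_compact)
    have "q \<notin> affine hull F"
    proof
      assume "q \<in> affine hull F"
      moreover have "affine hull F \<subseteq> {x. a \<bullet> x = b}"
        by (rule hull_minimal) (use F(3) in \<open>auto simp: affine_hyperplane\<close>)
      ultimately show False using T by (auto simp: T_def lev_def)
    qed
    then have "aff_dim (insert q F) = aff_dim F + 1" by (simp add: aff_dim_insert)
    moreover have "aff_dim K = int ?d" using K(3) by (simp add: aff_dim_nonempty_interior)
    ultimately have "aff_dim C = int ?d"
      using F(1) by (simp add: C_def aff_dim_convex_hull facet_of_def)
    then have "rel_interior C = interior C"
      by (intro rel_interior_interior) (simp add: aff_dim_eq_full)
    moreover have "rel_interior C \<noteq> {}"
      by (simp add: C_def rel_interior_eq_empty)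
    ultimately have "interior C \<noteq> {}" by simp
    then have vC: "0 < measure lebesgue C" using compC convex_body_measure_pos by blast
    have "measure lebesgue C / T * s \<le> G s" if s: "0 \<le> s" "s \<le> T" for s
    proof -
      define r where "r = 1 - s / T"
      have r: "0 \<le> r" "r \<le> 1" using s T by (auto simp: r_def field_simps)
      let ?h = "\<lambda>x. q + r *\<^sub>R (x - q)"
      have sub: "C \<subseteq> {x\<in>K. lev x \<le> s} \<union> ?h ` C"
      proof
        fix x assume x: "x \<in> C"
        then obtain u f where uf: "0 \<le> u" "u \<le> 1" "f \<in> F" "x = (1 - u) *\<^sub>R q + u *\<^sub>R f"
          using cF Fne hull_same[of convex F] unfolding C_def
          by (auto simp: convex_hull_insert_alt hull_same split: if_splits)
        then have xq: "x = q + u *\<^sub>R (f - q)" by (simp add: algebra_simps)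
        have "lev f = 0" using uf F(3) by (simp add: lev_def)
        then have lx: "lev x = T - u * T" unfolding xq levq by simp
        show "x \<in> {x\<in>K. lev x \<le> s} \<union> ?h ` C"
        proof (cases "lev x \<le> s")
          case True then show ?thesis using x CK by blast
        next
          case False
          moreover have "r * T = T - s" using T by (simp add: r_def left_diff_distrib)
          ultimately have "u * T < r * T" using lx by linarith
          then have ur: "u < r" using T by simp
          define y where "y = q + (u / r) *\<^sub>R (f - q)"
          have "y = (1 - u/r) *\<^sub>R q + (u/r) *\<^sub>R f" by (simp add: y_def algebra_simps)
          moreover have "q \<in> C" "f \<in> C" using uf(3) by (auto simp: C_def hull_inc)
          moreover have "0 \<le> u / r" "u / r \<le> 1" using ur uf(1) by auto
          ultimately have "y \<in> C"
            using convexD[OF convex_convex_hull[of "insert q F", folded C_def], of q f "1 - u/r" "u/r"] by simp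
          moreover have "x = ?h y" using ur uf(1) by (simp add: y_def xq)
          ultimately show ?thesis by blast
        qed
      qed
      have hm: "?h ` C \<in> lmeasurable"
        by (intro lmeasurable_compact compact_continuous_image continuous_intros compC)
      have "measure lebesgue C \<le> measure lebesgue ({x\<in>K. lev x \<le> s} \<union> ?h ` C)"
        using sub Sm hm Cm by (intro measure_mono_fmeasurable fmeasurable.Un) (auto simp: fmeasurableD)
      also have "\<dots> \<le> G s + measure lebesgue (?h ` C)"
        unfolding G_def using Sm hm by (intro measure_Un_le) (auto simp: fmeasurableD)
      also have "measure lebesgue (?h ` C) = r ^ ?d * measure lebesgue C"
        using r by (simp add: measure_homothety)
      also have "\<dots> \<le> r ^ 1 * measure lebesgue C"
        using r by (intro mult_right_mono power_decreasing) auto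
      finally have "(1 - r) * measure lebesgue C \<le> G s" by (simp add: algebra_simps)
      then show ?thesis by (simp add: r_def mult.commute)
    qed
    then show ?thesis using vC T by (intro exI[of _ "measure lebesgue C / T"]) auto
  qed
  have tile: "2 ^ ?d * G (s / 2) = (\<Sum>v\<in>?V. G (s - lev v))" for s
  proof -
    \<comment> \<open>On \<open>2K\<close> and on the translates \<open>v + K\<close> the levels of the two summands add up to \<open>2 * b - a \<bullet> z\<close>.\<close>
    let ?H = "{z. 2 * b - a \<bullet> z \<le> s}"
    have H: "closed ?H" by (intro closed_Collect_le continuous_intros)
    have "(*\<^sub>R) 2 ` K \<inter> ?H = (*\<^sub>R) 2 ` {x\<in>K. lev x \<le> s / 2}"
      by (auto simp: lev_def)
    then have "measure lebesgue ((*\<^sub>R) 2 ` K \<inter> ?H) = 2 ^ ?d * G (s / 2)"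
      by (simp add: measure_scaleR_image G_def)
    moreover have "measure lebesgue ((+) v ` K \<inter> ?H) = G (s - lev v)" for v
    proof -
      have "(+) v ` K \<inter> ?H = (+) v ` {x\<in>K. lev x \<le> s - lev v}"
        by (auto simp: lev_def inner_add_right)
      then show ?thesis by (simp add: measure_translation G_def)
    qed
    ultimately show ?thesis using vertex_translates_tile[OF K ev H] by simp
  qed
  have hom: "((T - t') / (T - t)) ^ ?d * (G (t + h) - G t) \<le> G (t' + h) - G t'"
    if t: "0 \<le> t" "t \<le> t'" "t' < T" "0 \<le> h" for t t' h
  proof -
    define r where "r = (T - t') / (T - t)"
    have r: "0 \<le> r" "r \<le> 1" "r * (T - t) = T - t'" using t by (auto simp: r_def)
    let ?f = "\<lambda>x. q + r *\<^sub>R (x - q)"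
    have "?f ` {x\<in>K. t < lev x \<and> lev x \<le> t + h} \<subseteq> {x\<in>K. t' < lev x \<and> lev x \<le> t' + h}"
    proof
      fix y assume "y \<in> ?f ` {x\<in>K. t < lev x \<and> lev x \<le> t + h}"
      then obtain x where x: "x \<in> K" "t < lev x" "lev x \<le> t + h" "y = ?f x" by auto
      have "y = (1 - r) *\<^sub>R q + r *\<^sub>R x" by (simp add: x algebra_simps)
      then have "y \<in> K" using convexD[OF K(2) q(1) x(1), of "1 - r" r] r by simp
      have ly: "lev y = t' + r * (lev x - t)"
        unfolding x levq using r(3) by (simp add: algebra_simps)
      have "0 < r" using t by (simp add: r_def)
      then have "0 < r * (lev x - t)" using x by simp
      moreover have "r * (lev x - t) \<le> h"
      proof -
        have "r * (lev x - t) \<le> lev x - t" using r x by (intro mult_left_le_one_le) auto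
        also have "\<dots> \<le> h" using x(3) by simp
        finally show ?thesis .
      qed
      ultimately show "y \<in> {x\<in>K. t' < lev x \<and> lev x \<le> t' + h}" using \<open>y \<in> K\<close> ly x by auto
    qed
    then have "measure lebesgue (?f ` {x\<in>K. t < lev x \<and> lev x \<le> t + h})
        \<le> measure lebesgue {x\<in>K. t' < lev x \<and> lev x \<le> t' + h}"
    proof (rule measure_mono_fmeasurable)
      have "?f ` {x\<in>K. t < lev x \<and> lev x \<le> t + h} \<in> lmeasurable"
      proof -
        have "{x\<in>K. t < lev x \<and> lev x \<le> t + h} = {x\<in>K. lev x \<le> t + h} - {x\<in>K. lev x \<le> t}"
          by auto
        moreover have "inj ?f" using t by (auto simp: inj_on_def r_def)
        ultimately have "?f ` {x\<in>K. t < lev x \<and> lev x \<le> t + h}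
            = ?f ` {x\<in>K. lev x \<le> t + h} - ?f ` {x\<in>K. lev x \<le> t}"
          by (simp add: image_set_diff)
        also have "\<dots> \<in> lmeasurable"
          by (intro fmeasurable.Diff fmeasurableD lmeasurable_compact compact_continuous_image
              continuous_intros compact_lev)
        finally show ?thesis .
      qed
      then show "?f ` {x\<in>K. t < lev x \<and> lev x \<le> t + h} \<in> sets lebesgue" by (rule fmeasurableD)
    qed (rule slab_m)
    then show ?thesis
      unfolding measure_homothety using t r by (simp add: diff r_def)
  qed
  obtain \<kappa> where \<kappa>: "0 < \<kappa>" "\<And>s. 0 \<le> s \<Longrightarrow> s \<le> T \<Longrightarrow> \<kappa> * s \<le> G s" using Gpos by blast
  have "lev v = 0 \<or> lev v = T" if v: "v extreme_point_of K" for v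
  proof (rule self_similar_slices_two_levels[OF fin card _ _ G0 _ \<kappa> tile hom])
    show "0 \<le> lev u" "lev u \<le> T" if "u \<in> ?V" for u
      using that lev0 q(2) by (auto simp: extreme_point_of_def T_def)
    show "0 \<le> G s" for s by (simp add: G_def)
    show "v \<in> ?V" using v by simp
  qed
  then show thesis using that[OF T] unfolding lev_def by force
qed

section \<open>Parallelotopes\<close>

lemma card_two_valued_vectors:
  fixes a b :: real
  assumes "a \<noteq> b"
  shows "finite {y :: real ^ 'n. \<forall>i. y $ i = a \<or> y $ i = b}"
    and "card {y :: real ^ 'n. \<forall>i. y $ i = a \<or> y $ i = b} = 2 ^ CARD('n)"
proof -
  let ?C = "{y :: real ^ 'n. \<forall>i. y $ i = a \<or> y $ i = b}"
  let ?h = "\<lambda>S :: 'n set. (\<chi> i. if i \<in> S then a else b) :: real ^ 'n"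
  have "y = ?h {i. y $ i = a}" if "y \<in> ?C" for y
    using that by (auto simp: vec_eq_iff)
  then have "?C \<subseteq> range ?h" by (intro subsetI range_eqI)
  moreover have "range ?h \<subseteq> ?C" by auto
  ultimately have C: "?C = range ?h" by (rule equalityI)
  have "inj ?h"
  proof (rule injI)
    fix S S' assume "?h S = ?h S'"
    then have "i \<in> S \<longleftrightarrow> i \<in> S'" for i using assms by (auto simp: vec_eq_iff split: if_splits)
    then show "S = S'" by blast
  qed
  then show "finite ?C" "card ?C = 2 ^ CARD('n)"
    unfolding C by (auto simp: card_image card_Pow simp flip: Pow_UNIV)
qed

text \<open>
  A direction orthogonal to all facet normals could be followed from an interior point to the boundary,
  hence to some facet, without any change of the functional that defines this facet.
\<close>

lemma facet_normals_span:
  fixes K :: "'a::euclidean_space set"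
  assumes K: "compact K" "convex K" "interior K \<noteq> {}" "polyhedron K"
  shows "span {a. \<exists>b. a \<noteq> 0 \<and> K \<subseteq> {x. a \<bullet> x \<le> b} \<and> K \<inter> {x. a \<bullet> x = b} facet_of K} = UNIV"
    (is "span ?A = UNIV")
proof (rule ccontr)
  assume "span ?A \<noteq> UNIV"
  then obtain y where y: "y \<noteq> 0" "span ?A \<subseteq> {x. y \<bullet> x = 0}"
    using span_not_univ_subset_hyperplane by blast
  obtain c0 where c0: "c0 \<in> interior K" using K(3) by blast
  obtain t where t: "0 < t" "c0 + t *\<^sub>R y \<in> frontier K"
    using ray_to_frontier[OF compact_imp_bounded[OF K(1)] c0 y(1)] by blast
  let ?x = "c0 + t *\<^sub>R y"
  have "?x \<in> K - rel_interior K"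
    using t(2) K(1) rel_interior_nonempty_interior[OF K(3)]
    by (simp add: frontier_def compact_imp_closed closure_closed)
  then obtain F where F: "F facet_of K" "?x \<in> F"
    unfolding rel_boundary_of_polyhedron[OF K(4)] by blast
  obtain a b where ab: "a \<noteq> 0" "K \<subseteq> {x. a \<bullet> x \<le> b}" "F = K \<inter> {x. a \<bullet> x = b}"
    using facet_of_polyhedron[OF K(4) F(1)] by metis
  then have "a \<in> ?A"
    using F(1) by (intro CollectI exI[of _ b] conjI) simp_all
  then have "a \<in> {x. y \<bullet> x = 0}" by (rule subsetD[OF y(2) span_base])
  then have "y \<bullet> a = 0" by simp
  then have "a \<bullet> ?x = a \<bullet> c0" by (simp add: inner_add_right inner_commute)
  moreover have "a \<bullet> ?x = b" using F(2) ab(3) by simp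
  moreover have "a \<bullet> c0 < b"
    using interior_mono[OF ab(2)] c0 interior_halfspace_le[OF ab(1), of b] by auto
  ultimately show False by simp
qed

text \<open>
  Among the functionals in \<open>A\<close> choose \<open>d\<close> independent ones, scaled so that they take the values \<open>0\<close> and
  \<open>1\<close> on \<open>V\<close>. They form an affine isomorphism, which embeds the \<open>2\<^sup>d\<close> points of \<open>V\<close> into the \<open>2\<^sup>d\<close>
  vertices of the unit cube, so it is onto and maps \<open>K\<close> to the cube.
\<close>

lemma parallelotope_if_two_levels:
  fixes K :: "(real ^ 'n) set" and A :: "(real ^ 'n) set"
  assumes V: "finite V" "card V = 2 ^ CARD('n)" "K = convex hull V" and A: "span A = UNIV"
    and lev: "\<And>a. a \<in> A \<Longrightarrow> \<exists>b T. 0 < T \<and> (\<forall>v\<in>V. a \<bullet> v = b \<or> a \<bullet> v = b - T)"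
  shows "parallelotope K"
proof -
  obtain B where B: "B \<subseteq> A" "independent B" "A \<subseteq> span B"
    using maximal_independent_subset[of A] by blast
  have sB: "span B = UNIV" using A B span_mono[OF B(3)] by (auto simp: span_span)
  have finB: "finite B" using B(2) by (rule independent_imp_finite)
  have "card B = CARD('n)"
    using basis_card_eq_dim[of B UNIV] B(2) sB by (simp add: dim_UNIV)
  then obtain \<alpha> :: "'n \<Rightarrow> real ^ 'n" where \<alpha>: "bij_betw \<alpha> UNIV B"
    using finB finite_same_card_bij[of "UNIV :: 'n set" B] by auto
  have "\<exists>b T. 0 < T \<and> (\<forall>v\<in>V. \<alpha> i \<bullet> v = b \<or> \<alpha> i \<bullet> v = b - T)" for i
  proof (rule lev)
    show "\<alpha> i \<in> A" using bij_betwE[OF \<alpha>] B(1) by auto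
  qed
  then obtain b T where T: "\<And>i. 0 < T i"
    and bT: "\<And>i v. v \<in> V \<Longrightarrow> \<alpha> i \<bullet> v = b i \<or> \<alpha> i \<bullet> v = b i - T i"
    by metis
  define L where "L x = (\<chi> i. - (\<alpha> i \<bullet> x) / T i)" for x :: "real ^ 'n"
  define \<beta> where "\<beta> = (\<chi> i. b i / T i)"
  have L: "linear L"
    by (rule linearI) (simp_all add: L_def vec_eq_iff inner_add_right add_divide_distrib diff_divide_distrib)
  have "inj L"
  proof (rule linear_injective_0[THEN iffD2, OF L], intro allI impI)
    fix x assume "L x = 0"
    then have "\<alpha> i \<bullet> x = 0" for i
      using T[of i] by (auto simp: L_def vec_eq_iff)
    then have "y \<bullet> x = 0" if "y \<in> B" for y using \<alpha> that by (auto simp: bij_betw_def)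
    then have "orthogonal x y" if "y \<in> span B" for y
      using orthogonal_to_span[OF that, of x] by (simp add: orthogonal_def inner_commute)
    then have "orthogonal x x" using sB by blast
    then show "x = 0" by (simp add: orthogonal_self)
  qed
  then obtain g where g: "linear g" "\<And>x. g (L x) = x" "\<And>x. L (g x) = x"
    using linear_injective_isomorphism[OF L] by blast
  let ?M = "\<lambda>x. \<beta> + L x" and ?C = "{y :: real ^ 'n. \<forall>i. y $ i = 0 \<or> y $ i = 1}"
  have "?M ` V = ?C"
  proof (rule card_subset_eq)
    show "?M ` V \<subseteq> ?C"
    proof (intro image_subsetI CollectI allI)
      fix v i assume "v \<in> V"
      then show "?M v $ i = 0 \<or> ?M v $ i = 1"
        using bT[of v i] T[of i] by (auto simp: L_def \<beta>_def field_simps)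
    qed
    have "inj_on ?M V" using \<open>inj L\<close> by (auto simp: inj_on_def)
    then show "card (?M ` V) = card ?C"
      using V(2) card_two_valued_vectors(2)[of 0 1, where 'n='n] by (simp add: card_image)
  qed (use card_two_valued_vectors(1)[of 0 1] in simp)
  then have cube: "?M ` K = cbox 0 1"
  proof -
    have "?M ` K = (+) \<beta> ` L ` (convex hull V)" unfolding V(3) by (simp add: image_image)
    also have "\<dots> = convex hull ((+) \<beta> ` L ` V)"
      by (simp add: convex_hull_linear_image[OF L] convex_hull_translation)
    also have "(+) \<beta> ` L ` V = ?C" using \<open>?M ` V = ?C\<close> by (simp add: image_image)
    also have "?C = {x. \<forall>j\<in>Basis. x \<bullet> j = 0 \<or> x \<bullet> j = 1}"
      by (simp add: Basis_vec_def inner_axis)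
    also have "convex hull \<dots> = cbox 0 1"
      unfolding Cart_1 by (rule unit_interval_convex_hull[symmetric])
    finally show ?thesis .
  qed
  let ?Q = "{x :: real ^ 'n. \<forall>i. x $ i \<in> {-1..1}}" and ?f = "\<lambda>x. g ((1/2) *\<^sub>R x)"
  let ?b = "g ((1/2) *\<^sub>R 1 - \<beta>)"
  have f_eq: "?f x + ?b = g ((1/2) *\<^sub>R (x + 1) - \<beta>)" for x
    using g(1) by (simp add: linear_diff linear_add algebra_simps)
  have "K = (\<lambda>x. ?f x + ?b) ` ?Q"
  proof (intro equalityI subsetI)
    fix k assume k: "k \<in> K"
    then have "?M k \<in> cbox 0 1" using cube by blast
    moreover have "2 *\<^sub>R y - 1 \<in> ?Q" if "y \<in> cbox 0 1" for y :: "real ^ 'n"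
      using that by (auto simp: mem_box_cart)
    ultimately have "2 *\<^sub>R ?M k - 1 \<in> ?Q" by blast
    moreover have "?f (2 *\<^sub>R ?M k - 1) + ?b = k"
      unfolding f_eq by (simp add: g(2))
    ultimately show "k \<in> (\<lambda>x. ?f x + ?b) ` ?Q" by (metis (no_types, lifting) imageI)
  next
    fix k assume "k \<in> (\<lambda>x. ?f x + ?b) ` ?Q"
    then obtain x where x: "x \<in> ?Q" "k = g ((1/2) *\<^sub>R (x + 1) - \<beta>)" using f_eq by auto
    have "(1/2) *\<^sub>R (x + 1) \<in> cbox 0 1"
      using x(1) by (auto simp: mem_box_cart) (smt (verit) field_sum_of_halves)+
    then obtain k' where k': "k' \<in> K" "?M k' = (1/2) *\<^sub>R (x + 1)" using cube by (metis (no_types, lifting) imageE)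
    then have "k = g (L k')" using x(2) by (metis add_diff_cancel_left')
    then show "k \<in> K" using g(2) k' by simp
  qed
  moreover have "linear ?f" using g(1)
    by (intro linear_compose[unfolded comp_def, of "(*\<^sub>R) (1/2)" g] linear_scaleR)
  moreover have "bij ?f"
    by (rule o_bij[of "\<lambda>x. 2 *\<^sub>R L x"]) (use g L in \<open>auto simp: fun_eq_iff linear_scale\<close>)
  ultimately show ?thesis unfolding parallelotope_def by blast
qed

lemma parallelotope_if_evenly_covered:
  fixes K :: "(real ^ 'n) set"
  assumes K: "compact K" "convex K" "interior K \<noteq> {}" and ev: "evenly_covered K"
  shows "parallelotope K"
proof -
  let ?V = "{v. v extreme_point_of K}"
  have V: "finite ?V" "card ?V = 2 ^ CARD('n)" "K = convex hull ?V"
    using card_extreme_points_le[OF K ev] card_extreme_points_ge[OF K ev]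
      Krein_Milman_Minkowski[OF K(1,2)] by auto
  then have "polyhedron K" using polytope_imp_polyhedron unfolding polytope_def by metis
  then have "span {a. \<exists>b. a \<noteq> 0 \<and> K \<subseteq> {x. a \<bullet> x \<le> b} \<and> K \<inter> {x. a \<bullet> x = b} facet_of K} = UNIV"
    by (rule facet_normals_span[OF K])
  then show ?thesis
  proof (rule parallelotope_if_two_levels[OF V])
    fix a assume "a \<in> {a. \<exists>b. a \<noteq> 0 \<and> K \<subseteq> {x. a \<bullet> x \<le> b} \<and> K \<inter> {x. a \<bullet> x = b} facet_of K}"
    then obtain b where ab: "a \<noteq> 0" "K \<subseteq> {x. a \<bullet> x \<le> b}" "K \<inter> {x. a \<bullet> x = b} facet_of K" by blast
    obtain T where T: "0 < T" "\<And>v. v extreme_point_of K \<Longrightarrow> a \<bullet> v = b \<or> a \<bullet> v = b - T"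
      by (rule facet_two_levels[OF K ev ab(3,2) refl ab(1)]) (rule that)
    show "\<exists>b T. 0 < T \<and> (\<forall>v\<in>?V. a \<bullet> v = b \<or> a \<bullet> v = b - T)"
      by (rule exI[of _ b], rule exI[of _ T]) (use T in simp)
  qed
qed

text \<open>
  A direction illuminates a vertex of the cube only if each of its coordinates has the sign opposite to that
  of the vertex, so it illuminates at most one vertex.
\<close>

lemma parallelotope_illumination_ge:
  fixes K :: "(real ^ 'n) set"
  assumes K: "parallelotope K"
  shows "2 ^ CARD('n) \<le> fractional_illumination_number K"
  unfolding fractional_illumination_number_def
proof (rule Inf_greatest)
  fix e assume "e \<in> {ereal (\<Sum>j<m. w j) |m u w. fractional_illumination K m u w}"
  then obtain m u w where e: "e = ereal (\<Sum>j<m. w j)" and fr: "fractional_illumination K m u w" by blast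
  let ?Q = "{x :: real ^ 'n. \<forall>i. x $ i \<in> {-1..1}}" and ?S = "{y :: real ^ 'n. \<forall>i. y $ i = -1 \<or> y $ i = 1}"
  obtain f b where f: "linear f" "bij f" and Kf: "K = (\<lambda>x. f x + b) ` ?Q"
    using K by (auto simp: parallelotope_def)
  have Q: "?Q = cbox (-1) 1" by (auto simp: mem_box_cart)
  have K': "K = (+) b ` f ` ?Q" unfolding Kf by (auto simp: image_image add.commute)
  have intK: "interior K = (+) b ` f ` box (-1) 1"
    unfolding K' interior_translation interior_bijective_linear_image[OF f] Q interior_cbox ..
  have mem: "f x + b \<in> interior K \<longleftrightarrow> x \<in> box (-1) 1" for x
    unfolding intK using bij_is_inj[OF f(2)] by (auto simp: image_iff add.commute inj_eq)
  have clK: "closed K"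
    unfolding K' Q using f(1)
    by (intro compact_imp_closed compact_translation compact_continuous_image linear_continuous_on linear_linear[THEN iffD2] compact_cbox)
  have vert: "f y + b \<in> frontier K" if y: "y \<in> ?S" for y
  proof -
    have "f y + b \<in> K" unfolding Kf
    proof (rule imageI, rule CollectI, rule allI)
      fix i show "y $ i \<in> {-1..1}" using y by (auto dest: spec[of _ i])
    qed
    moreover have "y \<notin> box (-1) 1"
    proof
      assume "y \<in> box (-1) 1"
      then have "-1 < y $ i \<and> y $ i < 1" for i by (simp add: mem_box_cart)
      moreover have "y $ i = -1 \<or> y $ i = 1" for i using y by simp
      ultimately show False by (metis less_irrefl)
    qed
    ultimately show ?thesis using mem clK by (simp add: frontier_def closure_closed)
  qed
  have sgn_eq: "y $ i = - sgn (inv f v $ i)" if y: "y \<in> ?S" and ill: "illuminates K v (f y + b)" for v y i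
  proof -
    obtain t where t: "0 < t" "f y + b + t *\<^sub>R v \<in> interior K" using ill by (auto simp: illuminates_def)
    have "v = f (inv f v)" using f(2) by (simp add: bij_is_surj surj_f_inv_f)
    then have "f y + b + t *\<^sub>R v = f (y + t *\<^sub>R inv f v) + b"
      using f(1) by (metis (no_types, lifting) add.assoc add.commute linear_add linear_scale)
    then have "f (y + t *\<^sub>R inv f v) + b \<in> interior K" using t(2) by (simp only:)
    then have "y + t *\<^sub>R inv f v \<in> box (-1) 1" by (simp only: mem)
    then have bd: "-1 < y $ i + t * inv f v $ i" "y $ i + t * inv f v $ i < 1" by (auto simp: mem_box_cart)
    consider "y $ i = -1" | "y $ i = 1" using y by blast
    then show ?thesis
    proof cases
      case 1
      then have "0 < inv f v $ i" using bd t(1) by (simp add: zero_less_mult_iff)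
      then show ?thesis using 1 by simp
    next
      case 2
      then have "inv f v $ i < 0" using bd t(1) by (simp add: mult_less_0_iff)
      then show ?thesis using 2 by simp
    qed
  qed
  define J where "J y = {j. j < m \<and> illuminates K (u j) (f y + b)}" for y
  have fin: "finite ?S" and card: "card ?S = 2 ^ CARD('n)"
    using card_two_valued_vectors[of "-1" 1, where 'n='n] by auto
  have "real (card ?S) = (\<Sum>y\<in>?S. 1)" by simp
  also have "\<dots> \<le> (\<Sum>y\<in>?S. \<Sum>j\<in>J y. w j)"
    using fr vert by (intro sum_mono) (auto simp: J_def fractional_illumination_def)
  also have "\<dots> = (\<Sum>j\<in>(\<Union>y\<in>?S. J y). w j)"
  proof (rule sum.UNION_disjoint[symmetric])
    show "\<forall>y\<in>?S. \<forall>z\<in>?S. y \<noteq> z \<longrightarrow> J y \<inter> J z = {}"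
    proof (intro ballI impI)
      fix y z assume yz: "y \<in> ?S" "z \<in> ?S" "y \<noteq> z"
      have False if "j \<in> J y" "j \<in> J z" for j
      proof -
        have "y $ i = z $ i" for i
          using sgn_eq[of y "u j" i] sgn_eq[of z "u j" i] yz that by (simp add: J_def)
        then show False using yz(3) by (simp add: vec_eq_iff)
      qed
      then show "J y \<inter> J z = {}" by blast
    qed
  qed (use fin in \<open>auto simp: J_def\<close>)
  also have "\<dots> \<le> (\<Sum>j<m. w j)"
    using fr by (intro sum_mono2) (auto simp: J_def fractional_illumination_def)
  finally have "2 ^ CARD('n) \<le> (\<Sum>j<m. w j)" unfolding card by simp
  then show "2 ^ CARD('n) \<le> e"
    unfolding e by (metis ereal_less_eq(3) ereal_power numeral_eq_ereal)
qed

theorem theorem1: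
  fixes K :: "(real ^ 'n) set"
  assumes "convex_body K"
  shows "fractional_illumination_number K \<le> 2 ^ CARD('n) \<and>
    (fractional_illumination_number K = 2 ^ CARD('n) \<longleftrightarrow> parallelotope K)"
proof -
  have K: "compact K" "convex K" "interior K \<noteq> {}" using assms by (auto simp: convex_body_def)
  have ne: "K \<noteq> {}" using K(3) by auto
  have le: "fractional_illumination_number K \<le> 2 ^ CARD('n)"
    by (rule illumination_number_le_two_power(1)[OF K])
  moreover have "parallelotope K" if "fractional_illumination_number K = 2 ^ CARD('n)"
  proof -
    have "min_energy K = (1/2) ^ DIM(real ^ 'n) * measure lebesgue K"
      using illumination_number_le_two_power(2)[OF K that] by simp
    then have "evenly_covered K" by (rule evenly_covered_if_min_energy[OF K(1,2) ne])
    then show ?thesis by (rule parallelotope_if_evenly_covered[OF K])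
  qed
  moreover have "fractional_illumination_number K = 2 ^ CARD('n)" if "parallelotope K"
    using le parallelotope_illumination_ge[OF that] by (rule order_antisym)
  ultimately show ?thesis by blast
qed

end
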